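(* Let $\Sigma$ be a finite monoid and $d\ge 1$. The generic $1$-parameter steady state bifurcations in the fundamental network of $\Sigma$ with $d$-dimensional internal dynamics are qualitatively the same as those for the same network with $1$-dimensional internal dynamics, in the sense that the reduced bifurcation problems are equivalent in both cases. That is, a $\Sigma$-representation is isomorphic to the generalized kernel of a generic $1$-parameter steady state bifurcation on $\bigoplus_{\sigma\in\Sigma}\mathbb R^d$ if and only if it is isomorphic to the generalized kernel of a generic $1$-parameter steady state bifurcation on $\bigoplus_{\sigma\in\Sigma}\mathbb R$, and the corresponding reduced bifurcation problems are equivalent.
   Context: Fundamental network: let $\Sigma=\{\sigma_1=\mathrm{Id},\dots,\sigma_n\}$ be a finite monoid and $V$ a finite-dimensional real vector space (internal phase space; "$d$-dimensional internal dynamics" means $\dim V=d$). $\Sigma$ acts on $\bigoplus_{\sigma\in\Sigma}V$ by the right regular representation $(A_\sigma v)_\tau=v_{\tau\sigma}$. Admissible $l$-parameter families are $\Gamma_f(v,\lambda)$, $\lambda\in\mathbb R^l$, with $(\Gamma_f(v,\lambda))_\sigma=f(v_{\sigma_1\sigma},\dots,v_{\sigma_n\sigma},\lambda)$, $f:V^n\times\mathbb R^l\to V$ smooth; equivalently (known), they are the smooth families equivariant under all $A_\sigma$. Bifurcations from the fully synchronous state $0$ at $\lambda=0$ are studied: $\Gamma_f(0,0)=0$ and, for a steady state bifurcation, $D_v\Gamma_f(0,0)$ has eigenvalue $0$. The generalized kernel is the generalized eigenspace of $D_v\Gamma_f(0,0)$ for the eigenvalue $0$; it is a complementable subrepresentation.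 Types: an indecomposable representation $U$ is of real type (= absolutely indecomposable), complex type or quaternionic type according to whether $\mathrm{End}_\Sigma(U)$ modulo its radical is $\mathbb R$, $\mathbb C$ or $\mathbb H$. The decomposition of $\bigoplus_{\sigma}V$ into indecomposable subrepresentations is unique up to isomorphism. Genericity (known classification, used as the meaning of "generic"): in a generic $1$-parameter steady state bifurcation the generalized kernel is isomorphic to exactly one absolutely indecomposable component of $\bigoplus_\sigma V$, and each such component does occur generically. Reduced problem: by equivariant Lyapunov–Schmidt/center manifold reduction the problem reduces to a generic $\Sigma$-equivariant family $r:U\times\mathbb R\to U$ on the generalized kernel $U$ with $r(0,0)=0$ and $D_ur(0,0)$ having $0$ as its only eigenvalue. Two reduced bifurcation problems are equivalent if they are posed on $\Sigma$-representations that are equivariantly isomorphic, so that conjugation by the isomorphism identifies the two classes of equivariant bifurcation problems. *)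

theory Defs
  imports "HOL-Analysis.Analysis" "HOL-Algebra.QuotRing"
begin

section \<open>Representations of a monoid on real vector spaces\<close>

text \<open>A monoid is a type of class \<open>monoid_mult\<close>. A representation is a linear subspace \<open>X\<close> of
  some ambient real vector space together with an action \<open>\<rho>\<close>, of which only the values on \<open>X\<close>
  matter. In this way subrepresentations are representations with the same \<open>\<rho>\<close>.\<close>

definition linear_between :: "'a::real_vector set \<Rightarrow> 'b::real_vector set \<Rightarrow> ('a \<Rightarrow> 'b) \<Rightarrow> bool" where
  "linear_between X Y \<phi> \<longleftrightarrow>
     \<phi> ` X \<subseteq> Y \<and>
     (\<forall>x\<in>X. \<forall>y\<in>X. \<phi> (x + y) = \<phi> x + \<phi> y) \<and>
     (\<forall>c. \<forall>x\<in>X. \<phi> (c *\<^sub>R x) = c *\<^sub>R \<phi> x)"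

definition monoid_representation ::
    "'a::real_vector set \<Rightarrow> ('m::monoid_mult \<Rightarrow> 'a \<Rightarrow> 'a) \<Rightarrow> bool" where
  "monoid_representation X \<rho> \<longleftrightarrow>
     subspace X \<and>
     (\<forall>\<sigma>. linear_between X X (\<rho> \<sigma>)) \<and>
     (\<forall>x\<in>X. \<rho> 1 x = x) \<and>
     (\<forall>\<sigma> \<tau>. \<forall>x\<in>X. \<rho> (\<sigma> * \<tau>) x = \<rho> \<sigma> (\<rho> \<tau> x))"

definition equivariant ::
    "'a::real_vector set \<Rightarrow> ('m \<Rightarrow> 'a \<Rightarrow> 'a) \<Rightarrow> 'b::real_vector set \<Rightarrow> ('m \<Rightarrow> 'b \<Rightarrow> 'b)
      \<Rightarrow> ('a \<Rightarrow> 'b) \<Rightarrow> bool" where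
  "equivariant X \<rho> Y \<rho>' \<phi> \<longleftrightarrow>
     linear_between X Y \<phi> \<and> (\<forall>\<sigma>. \<forall>x\<in>X. \<phi> (\<rho> \<sigma> x) = \<rho>' \<sigma> (\<phi> x))"

definition rep_iso ::
    "'a::real_vector set \<Rightarrow> ('m \<Rightarrow> 'a \<Rightarrow> 'a) \<Rightarrow> 'b::real_vector set \<Rightarrow> ('m \<Rightarrow> 'b \<Rightarrow> 'b)
      \<Rightarrow> ('a \<Rightarrow> 'b) \<Rightarrow> bool" where
  "rep_iso X \<rho> Y \<rho>' \<phi> \<longleftrightarrow> equivariant X \<rho> Y \<rho>' \<phi> \<and> bij_betw \<phi> X Y"

definition rep_isomorphic ::
    "'a::real_vector set \<Rightarrow> ('m \<Rightarrow> 'a \<Rightarrow> 'a) \<Rightarrow> 'b::real_vector set \<Rightarrow> ('m \<Rightarrow> 'b \<Rightarrow> 'b) \<Rightarrow> bool" where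
  "rep_isomorphic X \<rho> Y \<rho>' \<longleftrightarrow> (\<exists>\<phi>. rep_iso X \<rho> Y \<rho>' \<phi>)"

definition subrepresentation ::
    "'a::real_vector set \<Rightarrow> 'a set \<Rightarrow> ('m::monoid_mult \<Rightarrow> 'a \<Rightarrow> 'a) \<Rightarrow> bool" where
  "subrepresentation U X \<rho> \<longleftrightarrow> U \<subseteq> X \<and> monoid_representation U \<rho>"

definition internal_direct_sum :: "'a::real_vector set set \<Rightarrow> 'a set \<Rightarrow> bool" where
  "internal_direct_sum D X \<longleftrightarrow>
     finite D \<and> (\<forall>U\<in>D. U \<subseteq> X) \<and>
     (\<forall>x\<in>X. \<exists>!s. s \<in> (\<Pi>\<^sub>E U\<in>D. U) \<and> x = (\<Sum>U\<in>D. s U))"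

definition indecomposable ::
    "'a::real_vector set \<Rightarrow> ('m::monoid_mult \<Rightarrow> 'a \<Rightarrow> 'a) \<Rightarrow> bool" where
  "indecomposable X \<rho> \<longleftrightarrow>
     monoid_representation X \<rho> \<and> X \<noteq> {0} \<and>
     \<not> (\<exists>U W. subrepresentation U X \<rho> \<and> subrepresentation W X \<rho> \<and>
             U \<noteq> {0} \<and> W \<noteq> {0} \<and> U \<noteq> W \<and> internal_direct_sum {U, W} X)"

definition indecomposable_decomposition ::
    "'a::real_vector set set \<Rightarrow> 'a set \<Rightarrow> ('m::monoid_mult \<Rightarrow> 'a \<Rightarrow> 'a) \<Rightarrow> bool" where
  "indecomposable_decomposition D X \<rho> \<longleftrightarrow>
     internal_direct_sum D X \<and> (\<forall>U\<in>D. subrepresentation U X \<rho> \<and> indecomposable U \<rho>)"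

definition indecomposable_component ::
    "'a::real_vector set \<Rightarrow> 'a set \<Rightarrow> ('m::monoid_mult \<Rightarrow> 'a \<Rightarrow> 'a) \<Rightarrow> bool" where
  "indecomposable_component U X \<rho> \<longleftrightarrow> (\<exists>D. indecomposable_decomposition D X \<rho> \<and> U \<in> D)"


section \<open>Endomorphism rings and representations of real type\<close>

text \<open>Endomorphisms of \<open>X\<close> are taken in \<open>extensional X\<close>, so that two of them are equal as
  functions iff they agree on \<open>X\<close>.\<close>

definition endo_ring :: "'a::real_vector set \<Rightarrow> ('m \<Rightarrow> 'a \<Rightarrow> 'a) \<Rightarrow> ('a \<Rightarrow> 'a) ring" where
  "endo_ring X \<rho> =
     \<lparr>carrier = {\<phi> \<in> extensional X. equivariant X \<rho> X \<rho> \<phi>},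
      mult = (\<lambda>\<phi> \<psi>. compose X \<phi> \<psi>),
      one = (\<lambda>x\<in>X. x),
      zero = (\<lambda>x\<in>X. 0),
      add = (\<lambda>\<phi> \<psi>. \<lambda>x\<in>X. \<phi> x + \<psi> x)\<rparr>"

definition left_ideal :: "'r set \<Rightarrow> ('r, 'e) ring_scheme \<Rightarrow> bool" where
  "left_ideal I R \<longleftrightarrow>
     additive_subgroup I R \<and> (\<forall>a\<in>carrier R. \<forall>x\<in>I. a \<otimes>\<^bsub>R\<^esub> x \<in> I)"

definition maximal_left_ideal :: "'r set \<Rightarrow> ('r, 'e) ring_scheme \<Rightarrow> bool" where
  "maximal_left_ideal I R \<longleftrightarrow>
     left_ideal I R \<and> I \<noteq> carrier R \<and>
     (\<forall>J. left_ideal J R \<and> I \<subseteq> J \<longrightarrow> J = I \<or> J = carrier R)"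

text \<open>The Jacobson radical of a not necessarily commutative ring.\<close>

definition radical :: "('r, 'e) ring_scheme \<Rightarrow> 'r set" where
  "radical R = carrier R \<inter> \<Inter> {I. maximal_left_ideal I R}"

definition real_ring :: "real ring" where
  "real_ring = \<lparr>carrier = UNIV, mult = (*), one = 1, zero = 0, add = (+)\<rparr>"

text \<open>Being of real type is defined by an isomorphism of rings. Since the only ring endomorphism
  of the reals is the identity, every such isomorphism is one of real algebras.\<close>

definition absolutely_indecomposable ::
    "'a::real_vector set \<Rightarrow> ('m::monoid_mult \<Rightarrow> 'a \<Rightarrow> 'a) \<Rightarrow> bool" where
  "absolutely_indecomposable U \<rho> \<longleftrightarrow>
     indecomposable U \<rho> \<and> (endo_ring U \<rho> Quot radical (endo_ring U \<rho>)) \<simeq> real_ring"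


section \<open>Smooth maps and eigenvalues\<close>

text \<open>\<open>C_on k S f\<close> is only used for linear subspaces \<open>S\<close> of a Euclidean space and says that \<open>f\<close>
  is of class \<open>C\<^sup>k\<close> on \<open>S\<close>. For such \<open>S\<close>, the derivative within \<open>S\<close> is uniquely determined on the
  directions \<open>v \<in> S\<close>, and these are the only ones that are used.\<close>

primrec C_on ::
    "nat \<Rightarrow> 'a::euclidean_space set \<Rightarrow> ('a \<Rightarrow> 'b::euclidean_space) \<Rightarrow> bool" where
  "C_on 0 S f \<longleftrightarrow> continuous_on S f"
| "C_on (Suc k) S f \<longleftrightarrow>
     (\<exists>f'. (\<forall>x\<in>S. (f has_derivative f' x) (at x within S)) \<and>
           (\<forall>v\<in>S. C_on k S (\<lambda>x. f' x v)))"

definition smooth_on :: "'a::euclidean_space set \<Rightarrow> ('a \<Rightarrow> 'b::euclidean_space) \<Rightarrow> bool" where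
  "smooth_on S f \<longleftrightarrow> (\<forall>k. C_on k S f)"

text \<open>Complex eigenvalues of a real linear map \<open>L\<close> on a subspace \<open>U\<close>: the two equations are the
  real and imaginary parts of \<open>L (x + i y) = \<mu> (x + i y)\<close> in the complexification of \<open>U\<close>.\<close>

definition has_eigenvalue :: "'a::real_vector set \<Rightarrow> ('a \<Rightarrow> 'a) \<Rightarrow> complex \<Rightarrow> bool" where
  "has_eigenvalue U L \<mu> \<longleftrightarrow>
     (\<exists>x\<in>U. \<exists>y\<in>U. (x \<noteq> 0 \<or> y \<noteq> 0) \<and>
        L x = Re \<mu> *\<^sub>R x - Im \<mu> *\<^sub>R y \<and>
        L y = Im \<mu> *\<^sub>R x + Re \<mu> *\<^sub>R y)"


section \<open>Fundamental networks\<close>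

text \<open>The total phase space, the direct sum of copies of \<open>V\<close> indexed by the monoid \<open>'m\<close>, is
  \<open>('v, 'm) vec\<close>. The arguments of a response function are indexed by \<open>'m\<close> itself instead of by
  \<open>1, \<dots>, n\<close>, so the response function gets the argument
  \<open>\<chi> \<tau>. v $ (\<tau> * \<sigma>) = regular_action \<sigma> v\<close> in the cell \<open>\<sigma>\<close>.\<close>

type_synonym ('v, 'm) phase_space = "('v, 'm) vec"

definition regular_action ::
    "'m::{finite,monoid_mult} \<Rightarrow> ('v::euclidean_space, 'm) phase_space \<Rightarrow> ('v, 'm) phase_space" where
  "regular_action \<sigma> v = (\<chi> \<tau>. v $ (\<tau> * \<sigma>))"

definition network_field ::
    "(('v::euclidean_space, 'm::{finite,monoid_mult}) phase_space \<times> 'p \<Rightarrow> 'v) \<Rightarrow> ('v, 'm) phase_space \<Rightarrow> 'p \<Rightarrow> ('v, 'm) phase_space" where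
  "network_field f v l = (\<chi> \<sigma>. f ((\<chi> \<tau>. v $ (\<tau> * \<sigma>)), l))"

definition linearization ::
    "(('v::euclidean_space, 'm::{finite,monoid_mult}) phase_space \<times> real \<Rightarrow> 'v) \<Rightarrow> ('v, 'm) phase_space \<Rightarrow> ('v, 'm) phase_space" where
  "linearization f = frechet_derivative (\<lambda>v. network_field f v 0) (at 0)"

definition steady_state_bifurcation ::
    "(('v::euclidean_space, 'm::{finite,monoid_mult}) phase_space \<times> real \<Rightarrow> 'v) \<Rightarrow> bool" where
  "steady_state_bifurcation f \<longleftrightarrow>
     smooth_on UNIV f \<and> network_field f 0 0 = 0 \<and> has_eigenvalue UNIV (linearization f) 0"

definition generalized_kernel ::
    "(('v::euclidean_space, 'm::{finite,monoid_mult}) phase_space \<times> real \<Rightarrow> 'v) \<Rightarrow> ('v, 'm) phase_space set" where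
  "generalized_kernel f = {v. \<exists>k. (linearization f ^^ k) v = 0}"

text \<open>Genericity of a steady state bifurcation in a one-parameter family is understood in the sense
  of the known classification: the generalized kernel is a single absolutely indecomposable
  component of the total phase space, up to isomorphism.\<close>

definition generic_steady_state_bifurcation ::
    "(('v::euclidean_space, 'm::{finite,monoid_mult}) phase_space \<times> real \<Rightarrow> 'v) \<Rightarrow> bool" where
  "generic_steady_state_bifurcation f \<longleftrightarrow>
     steady_state_bifurcation f \<and>
     (\<exists>U :: ('v, 'm) phase_space set. indecomposable_component U UNIV regular_action \<and>
          absolutely_indecomposable U regular_action \<and>
          rep_isomorphic (generalized_kernel f) regular_action U regular_action)"


section \<open>Reduced bifurcation problems\<close>

text \<open>The class of one-parameter families on \<open>U\<close> to which bifurcation problems with generalized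
  kernel \<open>U\<close> reduce. When \<open>U\<close> is absolutely indecomposable, its members need no further genericity
  condition in the above sense: \<open>D\<close> is nilpotent, so the generalized kernel is all of \<open>U\<close>.\<close>

definition reduced_problems ::
    "'a::euclidean_space set \<Rightarrow> ('m \<Rightarrow> 'a \<Rightarrow> 'a) \<Rightarrow> ('a \<times> real \<Rightarrow> 'a) set" where
  "reduced_problems U \<rho> =
     {r \<in> (U \<times> UNIV) \<rightarrow>\<^sub>E U.
        smooth_on (U \<times> UNIV) r \<and>
        (\<forall>\<sigma>. \<forall>u\<in>U. \<forall>l. r (\<rho> \<sigma> u, l) = \<rho> \<sigma> (r (u, l))) \<and>
        r (0, 0) = 0 \<and>
        (\<exists>D. ((\<lambda>u. r (u, 0)) has_derivative D) (at 0 within U) \<and>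
             {\<mu>. has_eigenvalue U D \<mu>} = {0})}"

definition conjugate ::
    "('a \<Rightarrow> 'b) \<Rightarrow> 'a set \<Rightarrow> 'b set \<Rightarrow> ('a \<times> real \<Rightarrow> 'a) \<Rightarrow> ('b \<times> real \<Rightarrow> 'b)" where
  "conjugate \<phi> U W r = (\<lambda>(w, l) \<in> W \<times> UNIV. \<phi> (r (inv_into U \<phi> w, l)))"

definition reduced_problems_equivalent ::
    "'a::euclidean_space set \<Rightarrow> ('m \<Rightarrow> 'a \<Rightarrow> 'a) \<Rightarrow> 'b::euclidean_space set \<Rightarrow> ('m \<Rightarrow> 'b \<Rightarrow> 'b)
      \<Rightarrow> bool" where
  "reduced_problems_equivalent U \<rho> W \<rho>' \<longleftrightarrow>
     (\<exists>\<phi>. rep_iso U \<rho> W \<rho>' \<phi> \<and>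
          bij_betw (conjugate \<phi> U W) (reduced_problems U \<rho>) (reduced_problems W \<rho>'))"

end

theory Submission
  imports Defs
begin

text \<open>The phase space over \<open>\<real>\<^sup>d\<close> is a direct sum of \<open>d\<close> copies of the one over \<open>\<real>\<close>, with inclusions
  \<open>\<iota>\<^sub>j\<close> and projections \<open>\<pi>\<^sub>j\<close>. If \<open>U\<close> is an indecomposable component of one of the two spaces with
  projection \<open>p\<close>, then the identity of \<open>U\<close> is the sum of the endomorphisms factoring through the
  other space, \<open>p \<circ> \<iota>\<^sub>j \<circ> \<pi>\<^sub>j\<close> or \<open>p \<circ> \<pi>\<^sub>j \<circ> \<iota>\<^sub>j\<close>. By Fitting's lemma the endomorphism ring of \<open>U\<close> is
  local, so one summand is an isomorphism and \<open>U\<close> splits off the other space as well. Hence the two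
  spaces have the same indecomposable components, and each absolutely indecomposable one is the kernel
  of an equivariant projection, which is itself a linear network field. Reduced problems are then
  conjugated by the isomorphism of the generalized kernels.\<close>


section \<open>Representations and equivariant maps\<close>

text \<open>Uniqueness of decompositions is never invoked. Genericity only asks that the kernel be
  isomorphic to some absolutely indecomposable component, so it is enough to split off one
  isomorphic copy of \<open>U\<close> on the other side. Two things shape the rest. First, the copy
  must again be of real type. This holds because the quotient of the endomorphism ring by its
  radical is an isomorphism invariant, but that has to be traced through conjugation of
  endomorphisms, maximal left ideals, the radical and its cosets. Second, representations live on
  subspaces, and maps between them carry information only there. Dimension arguments and calculus
  are therefore carried out with linear extensions to the ambient spaces, and each use must check
  that the vectors involved stay in the subspace.\<close>

lemma linear_betweenD:
  assumes "linear_between X Y \<phi>"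
  shows "x \<in> X \<Longrightarrow> \<phi> x \<in> Y"
    and "x \<in> X \<Longrightarrow> y \<in> X \<Longrightarrow> \<phi> (x + y) = \<phi> x + \<phi> y"
    and "x \<in> X \<Longrightarrow> \<phi> (c *\<^sub>R x) = c *\<^sub>R \<phi> x"
  using assms by (auto simp: linear_between_def)

lemma linear_between_zero:
  assumes "linear_between X Y \<phi>" "subspace X"
  shows "\<phi> 0 = 0"
  using linear_betweenD(3)[OF assms(1), of 0 0] assms(2) by (simp add: subspace_0)

lemma linear_between_diff:
  assumes "linear_between X Y \<phi>" "subspace X" "x \<in> X" "y \<in> X"
  shows "\<phi> (x - y) = \<phi> x - \<phi> y"
  using linear_betweenD(2)[OF assms(1), of "x - y" y] assms by (simp add: subspace_diff)

lemma linear_between_sum: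
  assumes "linear_between X Y \<phi>" "subspace X" "\<And>i. i \<in> I \<Longrightarrow> s i \<in> X"
  shows "\<phi> (\<Sum>i\<in>I. s i) = (\<Sum>i\<in>I. \<phi> (s i))"
  using assms(3)
proof (induction I rule: infinite_finite_induct)
  case (insert i I)
  then show ?case
    using linear_betweenD(2)[OF assms(1), of "s i" "sum s I"] assms(2)
    by (simp add: subspace_sum)
qed (auto simp: linear_between_zero[OF assms(1,2)])

lemma linear_between_subspace_image:
  assumes "linear_between X Y \<phi>" "subspace X"
  shows "subspace (\<phi> ` X)"
  unfolding subspace_def
proof (intro conjI ballI allI)
  show "0 \<in> \<phi> ` X"
    using linear_between_zero[OF assms] subspace_0[OF assms(2)] by (metis imageI)
  show "x + y \<in> \<phi> ` X" if "x \<in> \<phi> ` X" "y \<in> \<phi> ` X" for x y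
    using that linear_betweenD(2)[OF assms(1)] subspace_add[OF assms(2)] by (metis (no_types) image_iff)
  show "c *\<^sub>R x \<in> \<phi> ` X" if "x \<in> \<phi> ` X" for c x
    using that linear_betweenD(3)[OF assms(1)] subspace_mul[OF assms(2)] by (metis (no_types) image_iff)
qed

text \<open>Prescribing the values of \<phi> on a basis of \<open>X\<close> determines a globally
  linear map, which gives access to facts about \<open>linear\<close> and
  \<open>bounded_linear\<close>. Only the values on \<open>X\<close> are ever used.\<close>

lemma linear_between_extend:
  assumes "linear_between X Y \<phi>" "subspace X"
  obtains \<Phi> where "linear \<Phi>" "\<And>x. x \<in> X \<Longrightarrow> \<Phi> x = \<phi> x"
proof -
  obtain B where B: "B \<subseteq> X" "independent B" "X \<subseteq> span B"
    using maximal_independent_subset by blast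
  obtain \<Phi> where \<Phi>: "linear \<Phi>" "\<And>x. x \<in> B \<Longrightarrow> \<Phi> x = \<phi> x"
    using linear_independent_extend[OF B(2)] by blast
  have "x \<in> X \<and> \<Phi> x = \<phi> x" if "x \<in> span B" for x
    using that
  proof (induction rule: span_induct_alt)
    case base
    then show ?case
      by (simp add: linear_0[OF \<Phi>(1)] linear_between_zero[OF assms] subspace_0[OF assms(2)])
  next
    case (step c x y)
    then have x: "x \<in> X" "c *\<^sub>R x \<in> X"
      using B(1) subspace_mul[OF assms(2)] by auto
    then show ?case
      using step linear_betweenD(2,3)[OF assms(1)] subspace_add[OF assms(2)]
      by (simp add: linear_add[OF \<Phi>(1)] linear_scale[OF \<Phi>(1)] \<Phi>(2))
  qed
  with \<Phi>(1) B(3) that show thesis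
    by blast
qed

text \<open>Rank-nullity on a finite-dimensional space. It turns injective or dimension-preserving
  endomorphisms into isomorphisms throughout.\<close>

lemma linear_between_inj_on_iff_surj:
  fixes X :: "'a::euclidean_space set"
  assumes "linear_between X X \<phi>" "subspace X"
  shows "inj_on \<phi> X \<longleftrightarrow> \<phi> ` X = X"
proof -
  obtain \<Phi> where \<Phi>: "linear \<Phi>" "\<And>x. x \<in> X \<Longrightarrow> \<Phi> x = \<phi> x"
    using linear_between_extend[OF assms] by blast
  have eq: "\<phi> ` X = \<Phi> ` X" "inj_on \<phi> X \<longleftrightarrow> inj_on \<Phi> X"
    using \<Phi>(2) by (auto cong: inj_on_cong)
  have sub: "\<Phi> ` X \<subseteq> X"
    using linear_betweenD(1)[OF assms(1)] \<Phi>(2) by auto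
  show ?thesis
  proof
    assume "inj_on \<phi> X"
    then have "dim (\<Phi> ` X) = dim X"
      using eq assms(2) by (intro dim_image_eq[OF \<Phi>(1)]) (metis span_eq_iff)
    then show "\<phi> ` X = X"
      using subspace_dim_equal[OF linear_subspace_image[OF \<Phi>(1) assms(2)] assms(2) sub] eq by simp
  next
    assume surj: "\<phi> ` X = X"
    obtain B where B: "B \<subseteq> X" "independent B" "X \<subseteq> span B" "card B = dim X"
      using basis_exists by blast
    have span_B: "span B = X"
      using B(1,3) span_minimal[OF B(1) assms(2)] by blast
    have fin: "finite B"
      by (rule independent_imp_finite[OF B(2)])
    \<comment> \<open>Counting: the image of the basis spans \<open>X\<close>, so it has at least
      \<open>dim X = card B\<close> elements. Hence \<Phi> is injective on \<open>B\<close>, and the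
      image is again a basis.\<close>
    have "X \<subseteq> span (\<Phi> ` B)"
      using surj eq span_B by (simp add: linear_span_image[OF \<Phi>(1)])
    moreover have "\<Phi> ` B \<subseteq> X"
      using B(1) sub by auto
    ultimately have "dim X \<le> card (\<Phi> ` B)"
      using dim_le_card fin by blast
    then have card: "card (\<Phi> ` B) = card B"
      using B(4) card_image_le[OF fin, of \<Phi>] by linarith
    then have inj: "inj_on \<Phi> B"
      using eq_card_imp_inj_on fin by blast
    have "independent (\<Phi> ` B)"
      using \<open>X \<subseteq> span (\<Phi> ` B)\<close> \<open>\<Phi> ` B \<subseteq> X\<close> card B(4) fin
      by (intro card_le_dim_spanning[of _ X]) auto
    then have "inj_on \<Phi> (span B)"
      using linear_inj_on_span_iff_independent_image[OF \<Phi>(1)] inj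
      by (metis \<Phi>(1) linear_inj_on_iff_eq_0 linear_inj_on_span_independent_image)
    then show "inj_on \<phi> X"
      using eq span_B by simp
  qed
qed

section \<open>Equivariant maps, their kernels and images\<close>

lemma monoid_representationD:
  assumes "monoid_representation X \<rho>"
  shows "subspace X" and "linear_between X X (\<rho> \<sigma>)" and "x \<in> X \<Longrightarrow> \<rho> \<sigma> x \<in> X"
    and "x \<in> X \<Longrightarrow> \<rho> 1 x = x" and "x \<in> X \<Longrightarrow> \<rho> (\<sigma> * \<tau>) x = \<rho> \<sigma> (\<rho> \<tau> x)"
  using assms linear_betweenD(1)[of X X "\<rho> \<sigma>" x] by (auto simp: monoid_representation_def)

lemma subrepresentationI:
  assumes "monoid_representation X \<rho>" "subspace U" "U \<subseteq> X" "\<And>\<sigma> x. x \<in> U \<Longrightarrow> \<rho> \<sigma> x \<in> U"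
  shows "subrepresentation U X \<rho>"
  using assms unfolding subrepresentation_def monoid_representation_def linear_between_def
  by (auto simp: subset_iff)

lemma subrepresentation_trans:
  "subrepresentation U W \<rho> \<Longrightarrow> subrepresentation W X \<rho> \<Longrightarrow> subrepresentation U X \<rho>"
  unfolding subrepresentation_def by auto

lemma equivariantD:
  assumes "equivariant X \<rho> Y \<rho>' \<phi>"
  shows "linear_between X Y \<phi>" and "x \<in> X \<Longrightarrow> \<phi> x \<in> Y"
    and "x \<in> X \<Longrightarrow> \<phi> (\<rho> \<sigma> x) = \<rho>' \<sigma> (\<phi> x)"
  using assms by (auto simp: equivariant_def linear_between_def)

lemma equivariant_compose:
  assumes "equivariant X \<rho> Y \<rho>' \<phi>" "equivariant Y \<rho>' Z \<rho>'' \<psi>"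
  shows "equivariant X \<rho> Z \<rho>'' (\<lambda>x. \<psi> (\<phi> x))"
  using assms unfolding equivariant_def linear_between_def by (auto simp: image_subset_iff)

lemma equivariant_cong:
  assumes "monoid_representation X \<rho>" "\<And>x. x \<in> X \<Longrightarrow> \<phi> x = \<psi> x"
  shows "equivariant X \<rho> Y \<rho>' \<phi> \<longleftrightarrow> equivariant X \<rho> Y \<rho>' \<psi>"
  using assms monoid_representationD[OF assms(1)] unfolding equivariant_def linear_between_def
  by (auto simp: image_subset_iff subspace_add subspace_mul)

lemma equivariant_subset:
  "equivariant X \<rho> Y \<rho>' \<phi> \<Longrightarrow> U \<subseteq> X \<Longrightarrow> \<phi> ` U \<subseteq> W \<Longrightarrow> equivariant U \<rho> W \<rho>' \<phi>"
  unfolding equivariant_def linear_between_def by (auto simp: subset_iff)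

lemma equivariant_id: "equivariant X \<rho> X \<rho> (\<lambda>x. x)"
  unfolding equivariant_def linear_between_def by auto

lemma equivariant_zero:
  assumes "monoid_representation Y \<rho>'"
  shows "equivariant X \<rho> Y \<rho>' (\<lambda>x. 0)"
  using linear_between_zero[OF monoid_representationD(2)[OF assms] monoid_representationD(1)[OF assms]]
    subspace_0[OF monoid_representationD(1)[OF assms]]
  by (auto simp: equivariant_def linear_between_def)

lemma equivariant_add:
  assumes "monoid_representation Y \<rho>'" "equivariant X \<rho> Y \<rho>' \<phi>" "equivariant X \<rho> Y \<rho>' \<psi>"
  shows "equivariant X \<rho> Y \<rho>' (\<lambda>x. \<phi> x + \<psi> x)"
proof -
  note Y = monoid_representationD[OF assms(1)]
  note \<phi> = equivariantD[OF assms(2)] and \<psi> = equivariantD[OF assms(3)]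
  show ?thesis
    unfolding equivariant_def linear_between_def
    using subspace_add[OF Y(1)] linear_betweenD(2)[OF Y(2)] \<phi> \<psi> linear_betweenD(2-3)[OF \<phi>(1)]
       linear_betweenD(2-3)[OF \<psi>(1)]
    by (auto simp: image_subset_iff scaleR_right_distrib)
qed

lemma equivariant_uminus:
  assumes "monoid_representation Y \<rho>'" "equivariant X \<rho> Y \<rho>' \<phi>"
  shows "equivariant X \<rho> Y \<rho>' (\<lambda>x. - \<phi> x)"
proof -
  note Y = monoid_representationD[OF assms(1)]
  note \<phi> = equivariantD[OF assms(2)]
  show ?thesis
    unfolding equivariant_def linear_between_def
    using subspace_neg[OF Y(1)] linear_betweenD(3)[OF Y(2), of _ _ "-1"] \<phi> linear_betweenD(2-3)[OF \<phi>(1)]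
    by (auto simp: image_subset_iff)
qed

lemma equivariant_sum:
  assumes "monoid_representation Y \<rho>'" "\<And>i. i \<in> I \<Longrightarrow> equivariant X \<rho> Y \<rho>' (h i)"
  shows "equivariant X \<rho> Y \<rho>' (\<lambda>x. \<Sum>i\<in>I. h i x)"
  using assms(2)
  by (induction I rule: infinite_finite_induct)
    (auto intro!: equivariant_zero[OF assms(1)] equivariant_add[OF assms(1)])

lemma equivariant_image_subrepresentation:
  assumes "monoid_representation X \<rho>" "monoid_representation Y \<rho>'" "equivariant X \<rho> Y \<rho>' \<phi>"
  shows "subrepresentation (\<phi> ` X) Y \<rho>'"
proof (rule subrepresentationI[OF assms(2)])
  note X = monoid_representationD[OF assms(1)] and \<phi> = equivariantD[OF assms(3)]
  show "subspace (\<phi> ` X)"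
    by (rule linear_between_subspace_image[OF \<phi>(1) X(1)])
  show "\<phi> ` X \<subseteq> Y"
    using \<phi>(2) by auto
  show "\<rho>' \<sigma> y \<in> \<phi> ` X" if "y \<in> \<phi> ` X" for \<sigma> y
    using that X(3) \<phi>(3) by (metis (no_types) image_iff)
qed

lemma equivariant_kernel_subrepresentation:
  assumes "monoid_representation X \<rho>" "monoid_representation Y \<rho>'" "equivariant X \<rho> Y \<rho>' \<phi>"
  shows "subrepresentation {x \<in> X. \<phi> x = 0} X \<rho>"
proof (rule subrepresentationI[OF assms(1)])
  note X = monoid_representationD[OF assms(1)] and \<phi> = equivariantD[OF assms(3)]
  note Y = monoid_representationD[OF assms(2)]
  show "subspace {x \<in> X. \<phi> x = 0}"
    using X(1) linear_between_zero[OF \<phi>(1) X(1)] linear_betweenD(2,3)[OF \<phi>(1)]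
    by (auto simp: subspace_def)
  show "\<rho> \<sigma> x \<in> {x \<in> X. \<phi> x = 0}" if "x \<in> {x \<in> X. \<phi> x = 0}" for \<sigma> x
    using that X(3) \<phi>(3) linear_between_zero[OF Y(2,1)] by auto
qed auto

section \<open>Isomorphisms of representations\<close>

lemma rep_isoD:
  assumes "rep_iso X \<rho> Y \<rho>' \<phi>"
  shows "equivariant X \<rho> Y \<rho>' \<phi>" and "bij_betw \<phi> X Y" and "\<phi> ` X = Y" and "inj_on \<phi> X"
  using assms by (auto simp: rep_iso_def bij_betw_def)

lemma rep_iso_inv_into:
  assumes "monoid_representation X \<rho>" "rep_iso X \<rho> Y \<rho>' \<phi>"
  shows "rep_iso Y \<rho>' X \<rho> (inv_into X \<phi>)"
proof -
  note X = monoid_representationD[OF assms(1)] and \<phi> = rep_isoD[OF assms(2)]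
  note \<phi>e = equivariantD[OF \<phi>(1)]
  note lin = linear_betweenD(2,3)[OF \<phi>e(1), symmetric]
  have "equivariant (\<phi> ` X) \<rho>' X \<rho> (inv_into X \<phi>)"
    unfolding equivariant_def linear_between_def
    using \<phi>(4) X(3) \<phi>e(3)[symmetric]
    by (auto simp: lin subspace_add[OF X(1)] subspace_mul[OF X(1)])
  then show ?thesis
    using \<phi>(2,3) bij_betw_inv_into by (auto simp: rep_iso_def)
qed

text \<open>Every element of \<open>Y\<close> is some \<open>\<phi> x\<close>, and equivariance
  computes \<open>\<rho>'\<close> there from \<rho>, so all axioms are inherited. In particular a
  generalized kernel becomes a representation through an isomorphism from a known one.\<close>

lemma rep_iso_monoid_representation:
  assumes "monoid_representation X \<rho>" "rep_iso X \<rho> Y \<rho>' \<phi>"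
  shows "monoid_representation Y \<rho>'"
proof -
  note X = monoid_representationD[OF assms(1)] and \<phi> = rep_isoD[OF assms(2)]
  note \<phi>e = equivariantD[OF \<phi>(1)]
  note lin = linear_betweenD(2,3)[OF \<phi>e(1)]
  have Y: "Y = \<phi> ` X"
    using \<phi>(3) by simp
  have sub: "subspace Y"
    using linear_between_subspace_image[OF \<phi>e(1) X(1)] Y by simp
  have "\<rho>' \<sigma> (\<phi> x + \<phi> y) = \<rho>' \<sigma> (\<phi> x) + \<rho>' \<sigma> (\<phi> y)" if "x \<in> X" "y \<in> X" for \<sigma> x y
    using that lin(1) \<phi>e(3) X(3) linear_betweenD(2)[OF X(2)] subspace_add[OF X(1)] by (metis (no_types))
  moreover have "\<rho>' \<sigma> (c *\<^sub>R \<phi> x) = c *\<^sub>R \<rho>' \<sigma> (\<phi> x)" if "x \<in> X" for \<sigma> c x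
    using that lin(2) \<phi>e(3) X(3) linear_betweenD(3)[OF X(2)] subspace_mul[OF X(1)] by (metis (no_types))
  moreover have "\<rho>' \<sigma> (\<phi> x) \<in> \<phi> ` X" "\<rho>' 1 (\<phi> x) = \<phi> x"
    "\<rho>' (\<sigma> * \<tau>) (\<phi> x) = \<rho>' \<sigma> (\<rho>' \<tau> (\<phi> x))" if "x \<in> X" for \<sigma> \<tau> x
    using that \<phi>e(3)[symmetric] X(3,4,5) by auto
  ultimately show ?thesis
    using sub unfolding monoid_representation_def linear_between_def Y by auto
qed

lemma rep_iso_compose:
  assumes "rep_iso X \<rho> Y \<rho>' \<phi>" "rep_iso Y \<rho>' Z \<rho>'' \<psi>"
  shows "rep_iso X \<rho> Z \<rho>'' (\<lambda>x. \<psi> (\<phi> x))"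
  using assms bij_betw_trans[of \<phi> X Y \<psi> Z] equivariant_compose[of X \<rho> Y \<rho>' \<phi> Z \<rho>'' \<psi>]
  by (simp add: rep_iso_def comp_def)

lemma rep_isomorphic_sym:
  "monoid_representation X \<rho> \<Longrightarrow> rep_isomorphic X \<rho> Y \<rho>' \<Longrightarrow> rep_isomorphic Y \<rho>' X \<rho>"
  unfolding rep_isomorphic_def using rep_iso_inv_into by blast

lemma rep_isomorphic_trans:
  "rep_isomorphic X \<rho> Y \<rho>' \<Longrightarrow> rep_isomorphic Y \<rho>' Z \<rho>'' \<Longrightarrow> rep_isomorphic X \<rho> Z \<rho>''"
  unfolding rep_isomorphic_def using rep_iso_compose by blast


section \<open>Decompositions into indecomposables\<close>

text \<open>A two-term direct sum as a relation on pairs. In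
  \<open>internal_direct_sum {U, W} X\<close> the index set collapses to a singleton when the two
  subspaces coincide, which this form avoids.\<close>

definition complementary :: "'a::real_vector set \<Rightarrow> 'a set \<Rightarrow> 'a set \<Rightarrow> bool" where
  "complementary U W X \<longleftrightarrow> U \<inter> W = {0} \<and> (\<forall>x\<in>X. \<exists>u\<in>U. \<exists>w\<in>W. x = u + w)"

text \<open>By linearity, uniqueness of coordinates reduces to uniqueness for the zero vector:
  subtract two decompositions. The coordinate functions here need not be extensional, so they can be
  written down freely.\<close>

lemma internal_direct_sum_iff:
  assumes "subspace X" "\<And>U. U \<in> D \<Longrightarrow> subspace U"
  shows "internal_direct_sum D X \<longleftrightarrow>
    finite D \<and> (\<forall>U\<in>D. U \<subseteq> X) \<and>
    (\<forall>x\<in>X. \<exists>s. (\<forall>U\<in>D. s U \<in> U) \<and> x = (\<Sum>U\<in>D. s U)) \<and>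
    (\<forall>s. (\<forall>U\<in>D. s U \<in> U) \<and> (\<Sum>U\<in>D. s U) = 0 \<longrightarrow> (\<forall>U\<in>D. s U = 0))"
    (is "_ \<longleftrightarrow> ?fin \<and> ?sub \<and> ?ex \<and> ?uniq")
proof
  assume L: "internal_direct_sum D X"
  then have ex1: "\<And>x. x \<in> X \<Longrightarrow> \<exists>!s. s \<in> (\<Pi>\<^sub>E U\<in>D. U) \<and> x = (\<Sum>U\<in>D. s U)"
    and fin: ?fin and sub: ?sub
    by (auto simp: internal_direct_sum_def)
  have ?ex
  proof
    fix x assume "x \<in> X"
    then obtain s where "s \<in> (\<Pi>\<^sub>E U\<in>D. U)" "x = (\<Sum>U\<in>D. s U)"
      using ex1 by blast
    then show "\<exists>s. (\<forall>U\<in>D. s U \<in> U) \<and> x = (\<Sum>U\<in>D. s U)"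
      by (auto simp: PiE_iff)
  qed
  moreover have "s U = 0" if s: "\<forall>U\<in>D. s U \<in> U" "(\<Sum>U\<in>D. s U) = 0" and "U \<in> D" for s U
  proof -
    have "restrict s D \<in> (\<Pi>\<^sub>E U\<in>D. U) \<and> 0 = (\<Sum>U\<in>D. restrict s D U)"
      using s by simp
    moreover have "(\<lambda>U\<in>D. 0) \<in> (\<Pi>\<^sub>E U\<in>D. U) \<and> 0 = (\<Sum>U\<in>D. (\<lambda>U\<in>D. 0) U)"
      using assms(2) by (auto simp: subspace_0)
    ultimately have "restrict s D = (\<lambda>U\<in>D. 0)"
      using ex1[OF subspace_0[OF assms(1)]] by blast
    then show ?thesis
      using \<open>U \<in> D\<close> by (metis restrict_apply')
  qed
  ultimately show "?fin \<and> ?sub \<and> ?ex \<and> ?uniq"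
    using fin sub by blast
next
  assume R: "?fin \<and> ?sub \<and> ?ex \<and> ?uniq"
  from R have ex: ?ex and uniq: ?uniq
    by - (elim conjE, assumption)+
  have "\<exists>!s. s \<in> (\<Pi>\<^sub>E U\<in>D. U) \<and> x = (\<Sum>U\<in>D. s U)" if x: "x \<in> X" for x
  proof -
    obtain s where s: "\<forall>U\<in>D. s U \<in> U" "x = (\<Sum>U\<in>D. s U)"
      using bspec[OF ex x] by (elim exE conjE)
    show ?thesis
    proof (rule ex1I[of _ "restrict s D"])
      show "restrict s D \<in> (\<Pi>\<^sub>E U\<in>D. U) \<and> x = (\<Sum>U\<in>D. restrict s D U)"
        using s by simp
      fix t assume t: "t \<in> (\<Pi>\<^sub>E U\<in>D. U) \<and> x = (\<Sum>U\<in>D. t U)"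
      have "\<forall>U\<in>D. t U - s U \<in> U"
        using t s assms(2) by (auto simp: PiE_iff subspace_diff)
      moreover have "(\<Sum>U\<in>D. t U - s U) = 0"
        using t s(2) by (simp add: sum_subtractf)
      ultimately have "\<forall>U\<in>D. t U - s U = 0"
        using uniq[THEN spec, of "\<lambda>U. t U - s U"] by blast
      then show "t = restrict s D"
        using t by (auto intro!: extensionalityI[of _ D] simp: PiE_iff)
    qed
  qed
  with R show "internal_direct_sum D X"
    unfolding internal_direct_sum_def by simp
qed

lemma internal_direct_sum_pair_iff:
  assumes "subspace X" "subspace U" "subspace W" "U \<noteq> W"
  shows "internal_direct_sum {U, W} X \<longleftrightarrow> U \<subseteq> X \<and> W \<subseteq> X \<and> complementary U W X"
proof -
  have "internal_direct_sum {U, W} X \<longleftrightarrow> U \<subseteq> X \<and> W \<subseteq> X \<and>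
      (\<forall>x\<in>X. \<exists>s. s U \<in> U \<and> s W \<in> W \<and> x = s U + s W) \<and>
      (\<forall>s. s U \<in> U \<and> s W \<in> W \<and> s U + s W = 0 \<longrightarrow> s U = 0 \<and> s W = 0)"
    using assms by (subst internal_direct_sum_iff) auto
  also have "(\<forall>x\<in>X. \<exists>s. s U \<in> U \<and> s W \<in> W \<and> x = s U + s W) \<longleftrightarrow>
      (\<forall>x\<in>X. \<exists>u\<in>U. \<exists>w\<in>W. x = u + w)"
  proof (intro ball_cong refl iffI)
    fix x assume "\<exists>u\<in>U. \<exists>w\<in>W. x = u + w"
    then obtain u w where "u \<in> U" "w \<in> W" "x = u + w"
      by blast
    then show "\<exists>s. s U \<in> U \<and> s W \<in> W \<and> x = s U + s W"
      \<comment> \<open>The updated constant function has value \<open>u\<close> at \<open>U\<close>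
        and \<open>w\<close> at \<open>W\<close>, because the two sets differ.\<close>
      using assms(4) by (intro exI[of _ "(\<lambda>_. w)(U := u)"]) auto
  qed auto
  also have "(\<forall>s. s U \<in> U \<and> s W \<in> W \<and> s U + s W = 0 \<longrightarrow> s U = 0 \<and> s W = 0) \<longleftrightarrow> U \<inter> W = {0}"
  proof (intro iffI allI impI)
    assume *: "\<forall>s. s U \<in> U \<and> s W \<in> W \<and> s U + s W = 0 \<longrightarrow> s U = 0 \<and> s W = 0"
    have "x = 0" if "x \<in> U" "x \<in> W" for x
      using *[rule_format, of "(\<lambda>_. - x)(U := x)"] that assms(3,4) by (auto simp: subspace_neg)
    then show "U \<inter> W = {0}"
      using assms(2,3) by (auto simp: subspace_0)
  next
    fix s :: "'a set \<Rightarrow> 'a"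
    assume "U \<inter> W = {0}"
    assume s: "s U \<in> U \<and> s W \<in> W \<and> s U + s W = 0"
    from s have eq: "s U = - s W"
      by (simp add: eq_neg_iff_add_eq_0)
    have "s U \<in> W"
      unfolding eq using s subspace_neg[OF assms(3)] by blast
    with s have "s U = 0"
      using \<open>U \<inter> W = {0}\<close> by blast
    with s show "s U = 0 \<and> s W = 0"
      by simp
  qed
  finally show ?thesis
    unfolding complementary_def by auto
qed

text \<open>The distinctness condition is absorbed: if \<open>U = W\<close>, complementarity gives
  \<open>U = U \<inter> W = {0}\<close>.\<close>

lemma indecomposable_iff:
  "indecomposable X \<rho> \<longleftrightarrow> monoid_representation X \<rho> \<and> X \<noteq> {0} \<and>
     (\<forall>U W. subrepresentation U X \<rho> \<and> subrepresentation W X \<rho> \<and> complementary U W X \<longrightarrow>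
        U = {0} \<or> W = {0})"
proof -
  have "U \<noteq> W \<and> internal_direct_sum {U, W} X \<longleftrightarrow> complementary U W X"
    if "monoid_representation X \<rho>" "subrepresentation U X \<rho>" "subrepresentation W X \<rho>" "U \<noteq> {0}" for U W
  proof -
    have "U \<noteq> W" if "complementary U W X"
      using that \<open>U \<noteq> {0}\<close> unfolding complementary_def by auto
    moreover have "U \<noteq> W \<Longrightarrow> internal_direct_sum {U, W} X \<longleftrightarrow> complementary U W X"
      using that internal_direct_sum_pair_iff[of X U W]
      by (auto simp: subrepresentation_def monoid_representationD(1))
    ultimately show ?thesis
      by blast
  qed
  then show ?thesis
    unfolding indecomposable_def not_ex
    by (intro conj_cong refl iff_allI) blast
qed

text \<open>Families of summands are sets, so a common member of \<open>D\<close> and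
  \<open>E\<close> would be counted once only. Such a member lies in
  \<open>U \<inter> W = {0}\<close>, hence equals \<open>{0}\<close>, which \<open>nz\<close>
  excludes from \<open>D\<close>.\<close>

lemma internal_direct_sum_union:
  assumes X: "subspace X" and UW: "U \<subseteq> X" "W \<subseteq> X" "complementary U W X"
    and sub: "subspace U" "subspace W" "\<And>V. V \<in> D \<union> E \<Longrightarrow> subspace V"
    and nz: "{0} \<notin> D"
    and D: "internal_direct_sum D U" and E: "internal_direct_sum E W"
  shows "internal_direct_sum (D \<union> E) X"
proof -
  have finD: "finite D" and D1: "\<And>V. V \<in> D \<Longrightarrow> V \<subseteq> U"
    and D2: "\<And>x. x \<in> U \<Longrightarrow> \<exists>s. (\<forall>V\<in>D. s V \<in> V) \<and> x = sum s D"
    and D3: "\<And>s. (\<forall>V\<in>D. s V \<in> V) \<Longrightarrow> sum s D = 0 \<Longrightarrow> (\<forall>V\<in>D. s V = 0)"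
    using D internal_direct_sum_iff[of U D] sub by auto
  have finE: "finite E" and E1: "\<And>V. V \<in> E \<Longrightarrow> V \<subseteq> W"
    and E2: "\<And>x. x \<in> W \<Longrightarrow> \<exists>s. (\<forall>V\<in>E. s V \<in> V) \<and> x = sum s E"
    and E3: "\<And>s. (\<forall>V\<in>E. s V \<in> V) \<Longrightarrow> sum s E = 0 \<Longrightarrow> (\<forall>V\<in>E. s V = 0)"
    using E internal_direct_sum_iff[of W E] sub by auto
  have disj: "D \<inter> E = {}"
  proof (rule ccontr)
    assume "D \<inter> E \<noteq> {}"
    then obtain V where V: "V \<in> D" "V \<in> E"
      by blast
    then have "V \<subseteq> {0}"
      using D1 E1 UW(3) unfolding complementary_def by blast
    moreover have "0 \<in> V"
      using V sub(3) subspace_0 by blast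
    ultimately show False
      using V nz by (metis subset_singletonD empty_iff)
  qed
  have sum_Un: "sum s (D \<union> E) = sum s D + sum s E" for s :: "'a set \<Rightarrow> 'a"
    by (rule sum.union_disjoint[OF finD finE disj])
  have "\<exists>s. (\<forall>V\<in>D \<union> E. s V \<in> V) \<and> x = sum s (D \<union> E)" if "x \<in> X" for x
  proof -
    obtain u w where uw: "u \<in> U" "w \<in> W" "x = u + w"
      using UW(3) \<open>x \<in> X\<close> unfolding complementary_def by blast
    obtain s where s: "\<forall>V\<in>D. s V \<in> V" "u = sum s D"
      using D2[OF uw(1)] by blast
    obtain t where t: "\<forall>V\<in>E. t V \<in> V" "w = sum t E"
      using E2[OF uw(2)] by blast
    define q where "q V = (if V \<in> D then s V else t V)" for V
    have "sum q D = sum s D" "sum q E = sum t E"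
      using disj by (auto simp: q_def intro!: sum.cong)
    then show ?thesis
      using s t uw(3) by (intro exI[of _ q]) (auto simp: q_def sum_Un)
  qed
  moreover have "\<forall>V\<in>D \<union> E. s V = 0" if s: "\<forall>V\<in>D \<union> E. s V \<in> V" "sum s (D \<union> E) = 0" for s
  proof -
    have "sum s D \<in> U" "sum s E \<in> W"
      using s(1) D1 E1 by (blast intro: subspace_sum[OF sub(1)] subspace_sum[OF sub(2)])+
    moreover have "sum s D = - sum s E"
      using s(2) by (simp add: sum_Un eq_neg_iff_add_eq_0)
    ultimately have "sum s D \<in> U \<inter> W" "sum s E \<in> U \<inter> W"
      using subspace_neg[OF sub(1), of "sum s D"] subspace_neg[OF sub(2), of "sum s E"] by auto
    then have zero: "sum s D = 0" "sum s E = 0"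
      using UW(3) unfolding complementary_def by auto
    have "\<forall>V\<in>D. s V \<in> V" "\<forall>V\<in>E. s V \<in> V"
      using s(1) unfolding ball_Un by (rule conjunct1, rule conjunct2)
    from D3[OF this(1) zero(1)] E3[OF this(2) zero(2)] show ?thesis
      unfolding ball_Un by (rule conjI)
  qed
  moreover have "\<forall>V\<in>D \<union> E. V \<subseteq> X"
    using D1 E1 UW(1,2) by blast
  ultimately show ?thesis
    using finD finE internal_direct_sum_iff[of X "D \<union> E", OF X sub(3)] by simp
qed

lemma indecomposable_decomposition_union:
  assumes X: "monoid_representation X \<rho>"
    and UW: "subrepresentation U X \<rho>" "subrepresentation W X \<rho>" "complementary U W X"
    and D: "indecomposable_decomposition D U \<rho>" and E: "indecomposable_decomposition E W \<rho>"
  shows "indecomposable_decomposition (D \<union> E) X \<rho>"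
proof -
  have sub: "subspace V" if "V \<in> D \<union> E" for V
    using that D E monoid_representationD(1)
    unfolding indecomposable_decomposition_def subrepresentation_def by blast
  have "{0} \<notin> D"
    using D unfolding indecomposable_decomposition_def indecomposable_def by blast
  then have "internal_direct_sum (D \<union> E) X"
    using UW D E X sub
    by (intro internal_direct_sum_union[of X U W D E])
      (auto simp: subrepresentation_def indecomposable_decomposition_def monoid_representationD(1))
  then show ?thesis
    using D E UW(1,2) subrepresentation_trans unfolding indecomposable_decomposition_def by blast
qed

lemma indecomposable_decomposition_singleton:
  assumes "indecomposable X \<rho>"
  shows "indecomposable_decomposition {X} X \<rho>"
proof -
  have "monoid_representation X \<rho>"
    using assms by (simp add: indecomposable_def)
  then have "subspace X" "subrepresentation X X \<rho>"
    by (auto simp: monoid_representationD(1) subrepresentation_def)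
  moreover have "\<exists>s. (\<forall>U\<in>{X}. s U \<in> U) \<and> x = (\<Sum>U\<in>{X}. s U)" if "x \<in> X" for x
    using that by (intro exI[of _ "\<lambda>_. x"]) simp
  ultimately show ?thesis
    using assms unfolding indecomposable_decomposition_def
    by (subst internal_direct_sum_iff) simp_all
qed

text \<open>Strong induction on the dimension: both parts of a nontrivial splitting have smaller
  dimension.\<close>

lemma ex_indecomposable_decomposition:
  fixes X :: "'a::euclidean_space set"
  assumes "monoid_representation X \<rho>"
  shows "\<exists>D. indecomposable_decomposition D X \<rho>"
  using assms
proof (induction "dim X" arbitrary: X rule: less_induct)
  case less
  note X = monoid_representationD(1)[OF less.prems]
  consider "X = {0}" | "indecomposable X \<rho>" | "X \<noteq> {0}" "\<not> indecomposable X \<rho>"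
    by blast
  then show ?case
  proof cases
    case 1
    \<comment> \<open>The zero space is the empty sum. The singleton \<open>{X}\<close> would not
      do, since indecomposables are nonzero.\<close>
    then have "indecomposable_decomposition {} X \<rho>"
      unfolding indecomposable_decomposition_def using X by (subst internal_direct_sum_iff) auto
    then show ?thesis ..
  next
    case 2
    then show ?thesis
      using indecomposable_decomposition_singleton by blast
  next
    case 3
    then obtain U W where UW: "subrepresentation U X \<rho>" "subrepresentation W X \<rho>"
        "complementary U W X" "U \<noteq> {0}" "W \<noteq> {0}"
      using less.prems by (auto simp: indecomposable_iff)
    have sub: "U \<subseteq> X" "W \<subseteq> X" "monoid_representation U \<rho>" "monoid_representation W \<rho>"
      using UW(1,2) by (auto simp: subrepresentation_def)
    note subs = monoid_representationD(1)[OF sub(3)] monoid_representationD(1)[OF sub(4)]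
    \<comment> \<open>Otherwise \<open>W \<subseteq> U\<close>, so that
      \<open>W = U \<inter> W = {0}\<close>.\<close>
    have "U \<noteq> X"
      using UW(3,5) sub(2) subspace_0[OF subs(2)] unfolding complementary_def by auto
    moreover have "W \<noteq> X"
      using UW(3,4) sub(1) subspace_0[OF subs(1)] unfolding complementary_def by auto
    ultimately have "dim U < dim X" "dim W < dim X"
      using sub subs X by (metis linorder_not_less subspace_dim_equal)+
    then obtain D E where "indecomposable_decomposition D U \<rho>" "indecomposable_decomposition E W \<rho>"
      using less.hyps sub(3,4) by meson
    then show ?thesis
      using indecomposable_decomposition_union[OF less.prems UW(1-3)] by blast
  qed
qed

text \<open>A component has to belong to a full decomposition; one is obtained by decomposing the
  complement \<open>W\<close>.\<close>

lemma indecomposable_componentI: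
  fixes X :: "'a::euclidean_space set"
  assumes "monoid_representation X \<rho>" "subrepresentation U X \<rho>" "subrepresentation W X \<rho>"
    and "complementary U W X" "indecomposable U \<rho>"
  shows "indecomposable_component U X \<rho>"
proof -
  obtain E where "indecomposable_decomposition E W \<rho>"
    using ex_indecomposable_decomposition assms(3) unfolding subrepresentation_def by blast
  then have "indecomposable_decomposition ({U} \<union> E) X \<rho>"
    using indecomposable_decomposition_union[OF assms(1-4)]
      indecomposable_decomposition_singleton[OF assms(5)] by blast
  then show ?thesis
    unfolding indecomposable_component_def by blast
qed

text \<open>The projection is the coordinate at \<open>U\<close>. Sums, multiples and translates
  under the action of decompositions are again decompositions, so uniqueness of coordinates makes it
  linear and equivariant.\<close>

lemma indecomposable_component_projection:
  assumes "monoid_representation X \<rho>" "indecomposable_component U X \<rho>"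
  obtains p where "equivariant X \<rho> U \<rho> p" "\<And>u. u \<in> U \<Longrightarrow> p u = u"
proof -
  obtain D where D: "internal_direct_sum D X" "U \<in> D"
      "\<And>V. V \<in> D \<Longrightarrow> V \<subseteq> X \<and> monoid_representation V \<rho>"
    using assms(2)
    unfolding indecomposable_component_def indecomposable_decomposition_def subrepresentation_def
    by blast
  note X = monoid_representationD[OF assms(1)]
  have V: "subspace V" if "V \<in> D" for V
    using D(3)[OF that] monoid_representationD(1) by blast
  have fin: "finite D" and ex: "\<And>x. x \<in> X \<Longrightarrow> \<exists>s. (\<forall>V\<in>D. s V \<in> V) \<and> x = sum s D"
    and uniq: "\<And>s. (\<forall>V\<in>D. s V \<in> V) \<Longrightarrow> sum s D = 0 \<Longrightarrow> (\<forall>V\<in>D. s V = 0)"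
    using D(1) internal_direct_sum_iff[OF X(1) V] by auto
  from ex have "\<forall>x\<in>X. \<exists>s. (\<forall>V\<in>D. s V \<in> V) \<and> x = sum s D" ..
  from bchoice[OF this] obtain s
    where "\<forall>x\<in>X. (\<forall>V\<in>D. s x V \<in> V) \<and> x = sum (s x) D" ..
  then have s: "\<And>x V. x \<in> X \<Longrightarrow> V \<in> D \<Longrightarrow> s x V \<in> V" "\<And>x. x \<in> X \<Longrightarrow> sum (s x) D = x"
    by auto
  \<comment> \<open>Any convenient decomposition \<open>t\<close> computes the chosen coordinate, so
    each property below only needs a suitable \<open>t\<close>.\<close>
  have s_eq: "s x U = t U" if "x \<in> X" "\<forall>V\<in>D. t V \<in> V" "x = sum t D" for x t
  proof -
    have "\<forall>V\<in>D. s x V - t V \<in> V"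
      using s(1)[OF that(1)] that(2) V subspace_diff by blast
    moreover have "(\<Sum>V\<in>D. s x V - t V) = 0"
      unfolding sum_subtractf s(2)[OF that(1)] using that(3) by simp
    ultimately have "\<forall>V\<in>D. s x V - t V = 0"
      by (rule uniq)
    with \<open>U \<in> D\<close> have "s x U - t U = 0"
      by (rule bspec[rotated])
    then show ?thesis
      by simp
  qed
  have "equivariant X \<rho> U \<rho> (\<lambda>x. s x U)"
    unfolding equivariant_def linear_between_def
  proof (intro conjI ballI allI)
    show "(\<lambda>x. s x U) ` X \<subseteq> U"
      using s(1) D(2) by auto
    show "s (x + y) U = s x U + s y U" if "x \<in> X" "y \<in> X" for x y
      by (intro s_eq ballI subspace_add[OF V] subspace_add[OF X(1)] s(1) that)
        (simp_all add: sum.distrib s(2) that)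
    show "s (c *\<^sub>R x) U = c *\<^sub>R s x U" if "x \<in> X" for c x
      by (intro s_eq ballI subspace_mul[OF V] subspace_mul[OF X(1)] s(1) that)
        (simp_all add: s(2) that flip: scaleR_sum_right)
    show "s (\<rho> \<sigma> x) U = \<rho> \<sigma> (s x U)" if "x \<in> X" for \<sigma> x
    proof (rule s_eq)
      show "\<rho> \<sigma> x \<in> X"
        using X(3) that .
      show "\<forall>V\<in>D. \<rho> \<sigma> (s x V) \<in> V"
        using D(3) s(1) that monoid_representationD(3) by blast
      have "\<rho> \<sigma> x = \<rho> \<sigma> (sum (s x) D)"
        using s(2)[OF that] by simp
      also have "\<dots> = (\<Sum>V\<in>D. \<rho> \<sigma> (s x V))"
        by (rule linear_between_sum[OF X(2,1)]) (rule subsetD[OF D(3)[THEN conjunct1] s(1)[OF that]])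
      finally show "\<rho> \<sigma> x = (\<Sum>V\<in>D. \<rho> \<sigma> (s x V))" .
    qed
  qed
  moreover have "s u U = u" if "u \<in> U" for u
  proof -
    have "\<forall>V\<in>D. (if V = U then u else 0) \<in> V"
      using that V subspace_0 by auto
    moreover have "u = (\<Sum>V\<in>D. if V = U then u else 0)"
      using fin D(2) by simp
    ultimately show ?thesis
      using s_eq[of u "\<lambda>V. if V = U then u else 0"] that D(2,3) by auto
  qed
  ultimately show thesis
    using that by blast
qed


section \<open>Local endomorphism rings\<close>

lemma equivariant_funpow:
  "equivariant X \<rho> X \<rho> h \<Longrightarrow> equivariant X \<rho> X \<rho> (h ^^ k)"
  by (induction k) (auto simp: equivariant_def linear_between_def image_subset_iff)

text \<open>Fitting's lemma: once the ranks of the powers of \<open>h\<close> are stationary, the image and the kernel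
  of the power are complementary.\<close>

lemma indecomposable_nilpotent_or_inj:
  fixes X :: "'a::euclidean_space set"
  assumes "indecomposable X \<rho>" "equivariant X \<rho> X \<rho> h"
  shows "(\<exists>k. \<forall>x\<in>X. (h ^^ k) x = 0) \<or> inj_on h X"
proof -
  have rep: "monoid_representation X \<rho>"
    using assms(1) by (simp add: indecomposable_def)
  note X = monoid_representationD[OF rep]
  note eq = equivariant_funpow[OF assms(2)]
  note lin = equivariantD(1)[OF eq]
  \<comment> \<open>The exponent \<open>k\<close> minimizes the rank over all powers, so later
    powers cannot shrink the image further.\<close>
  obtain k where k: "\<And>j. dim ((h ^^ k) ` X) \<le> dim ((h ^^ j) ` X)"
    using arg_min_nat_le[of "\<lambda>_. True" _ "\<lambda>j. dim ((h ^^ j) ` X)"] by blast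
  define I where "I = (h ^^ k) ` X"
  define K where "K = {x \<in> X. (h ^^ k) x = 0}"
  have I: "subrepresentation I X \<rho>"
    unfolding I_def by (rule equivariant_image_subrepresentation[OF rep rep eq])
  have K: "subrepresentation K X \<rho>"
    unfolding K_def by (rule equivariant_kernel_subrepresentation[OF rep rep eq])
  have "I \<subseteq> X" "monoid_representation I \<rho>"
    using I by (auto simp: subrepresentation_def)
  note subI = monoid_representationD(1)[OF this(2)]
  have pow: "(h ^^ j) ` I = (h ^^ (j + k)) ` X" for j
    by (simp add: I_def funpow_add image_comp)
  have "(h ^^ k) ` X \<subseteq> X"
    using \<open>I \<subseteq> X\<close> I_def by simp
  have stable: "(h ^^ j) ` I = I" for j
  proof (rule subspace_dim_equal)
    show "subspace ((h ^^ j) ` I)"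
      unfolding pow by (rule linear_between_subspace_image[OF lin X(1)])
    \<comment> \<open>Powers of \<open>h\<close> commute, so the image of the later power lies in
      \<open>I\<close>; minimality of the rank then forces equality.\<close>
    have "(h ^^ (j + k)) ` X = (h ^^ k) ` ((h ^^ j) ` X)"
      by (simp add: image_comp add.commute flip: funpow_add)
    also have "\<dots> \<subseteq> I"
      unfolding I_def using equivariantD(2)[OF eq] by (intro image_mono) auto
    finally show "(h ^^ j) ` I \<subseteq> I"
      unfolding pow .
    show "dim I \<le> dim ((h ^^ j) ` I)"
      unfolding pow unfolding I_def by (rule k)
  qed (rule subI)
  have linI: "linear_between I I (h ^^ j)" for j
    using lin[of j] stable[of j] \<open>I \<subseteq> X\<close> unfolding linear_between_def by blast
  have inj: "inj_on (h ^^ j) I" for j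
    using linear_between_inj_on_iff_surj[OF linI subI] stable by blast
  have "complementary I K X"
    unfolding complementary_def
  proof (intro conjI ballI)
    have "x = 0" if "x \<in> I" "x \<in> K" for x
      using inj_onD[OF inj[of k], of x 0] that linear_between_zero[OF lin X(1)] subspace_0[OF subI]
      by (simp add: K_def)
    then show "I \<inter> K = {0}"
      using subI linear_between_zero[OF lin X(1)] X(1) by (auto simp: subspace_0 K_def)
    fix x assume x: "x \<in> X"
    then have "(h ^^ k) x \<in> (h ^^ k) ` I"
      unfolding stable by (simp add: I_def)
    \<comment> \<open>Since the power maps \<open>I\<close> onto itself, the value at
      \<open>x\<close> is already attained at some \<open>w\<close> in \<open>I\<close>, and
      \<open>x - w\<close> is the kernel part of \<open>x\<close>.\<close>
    then obtain w where w: "w \<in> I" "(h ^^ k) x = (h ^^ k) w"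
      by blast
    then have "x - w \<in> K"
      using \<open>I \<subseteq> X\<close> x linear_between_diff[OF lin X(1)] subspace_diff[OF X(1)] by (auto simp: K_def)
    with w(1) show "\<exists>u\<in>I. \<exists>w\<in>K. x = u + w"
      by (intro bexI[of _ w] bexI[of _ "x - w"]) auto
  qed
  then have "I = {0} \<or> K = {0}"
    using assms(1) I K unfolding indecomposable_iff by blast
  then show ?thesis
  proof
    assume "I = {0}"
    then have "\<forall>x\<in>X. (h ^^ k) x = 0"
      by (auto simp: I_def)
    then show ?thesis
      by blast
  next
    assume "K = {0}"
    have "I = X"
    proof (rule subspace_dim_equal[OF subI X(1) \<open>I \<subseteq> X\<close>])
      have "inj_on (h ^^ k) X"
      proof (rule inj_onI)
        fix x y assume "x \<in> X" "y \<in> X" "(h ^^ k) x = (h ^^ k) y"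
        then have "x - y \<in> K"
          by (simp add: K_def linear_between_diff[OF lin X(1)] subspace_diff[OF X(1)])
        then show "x = y"
          using \<open>K = {0}\<close> by simp
      qed
      then show "dim X \<le> dim I"
        using linear_between_inj_on_iff_surj[OF lin X(1)] by (simp add: I_def)
    qed
    then show ?thesis
      using inj[of 1] by simp
  qed
qed

text \<open>The endomorphism ring of an indecomposable representation is local.\<close>

lemma indecomposable_inj_summand:
  fixes X :: "'a::euclidean_space set"
  assumes "indecomposable X \<rho>" "finite J" "\<And>j. j \<in> J \<Longrightarrow> equivariant X \<rho> X \<rho> (h j)"
    and "inj_on (\<lambda>x. \<Sum>j\<in>J. h j x) X"
  shows "\<exists>j\<in>J. inj_on (h j) X"
  using assms(2-)
proof (induction J rule: finite_induct)
  case empty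
  \<comment> \<open>The empty sum is the zero map, which is not injective on a nonzero
    space.\<close>
  have "X \<noteq> {0}" "subspace X"
    using assms(1) monoid_representationD(1) by (auto simp: indecomposable_def)
  then have "\<exists>x\<in>X. x \<noteq> 0" "0 \<in> X"
    using subspace_0 by blast+
  then show ?case
    using empty.prems by (auto simp: inj_on_def)
next
  case (insert a J)
  have rep: "monoid_representation X \<rho>"
    using assms(1) by (simp add: indecomposable_def)
  note X = monoid_representationD[OF rep]
  define H where "H x = (\<Sum>j\<in>J. h j x)" for x
  \<comment> \<open>\<open>g\<close> is the whole sum, hence an automorphism. The dichotomy is
    applied to the inverse of \<open>g\<close> after \<open>h a\<close>: either it is injective, and
    then so is \<open>h a\<close>, or it is nilpotent.\<close>
  define g where "g x = h a x + H x" for x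
  have eqH: "equivariant X \<rho> X \<rho> H"
    unfolding H_def using insert.prems(1) by (intro equivariant_sum[OF rep]) auto
  have eqa: "equivariant X \<rho> X \<rho> (h a)"
    using insert.prems(1) by auto
  have eqg: "equivariant X \<rho> X \<rho> g"
    unfolding g_def by (intro equivariant_add[OF rep] eqH eqa)
  have "inj_on g X"
    using insert by (simp add: g_def[abs_def] H_def)
  then have "rep_iso X \<rho> X \<rho> g"
    using eqg linear_between_inj_on_iff_surj[OF equivariantD(1)[OF eqg] X(1)]
    by (simp add: rep_iso_def bij_betw_def)
  then have "rep_iso X \<rho> X \<rho> (inv_into X g)"
    by (rule rep_iso_inv_into[OF rep])
  note q = rep_isoD[OF this]
  have "equivariant X \<rho> X \<rho> (\<lambda>x. inv_into X g (h a x))"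
    by (rule equivariant_compose[OF eqa q(1)])
  from indecomposable_nilpotent_or_inj[OF assms(1) this]
  show ?case
  proof
    assume "inj_on (\<lambda>x. inv_into X g (h a x)) X"
    then have "inj_on (h a) X"
      by (auto simp: inj_on_def)
    then show ?case
      by blast
  next
    let ?n = "\<lambda>x. inv_into X g (h a x)"
    assume "\<exists>k. \<forall>x\<in>X. (?n ^^ k) x = 0"
    then obtain k where k: "\<And>x. x \<in> X \<Longrightarrow> (?n ^^ k) x = 0"
      by blast
    \<comment> \<open>If \<open>H z = 0\<close>, then \<open>h a z = g z\<close>, so
      \<open>z\<close> is fixed by the nilpotent map \<open>?n\<close> and must vanish. The
      remaining sum is thus injective and the induction hypothesis applies to it.\<close>
    have "inj_on H X"
    proof (rule inj_onI)
      fix x y assume xy: "x \<in> X" "y \<in> X" "H x = H y"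
      define z where "z = x - y"
      have z: "z \<in> X"
        using xy subspace_diff[OF X(1)] by (simp add: z_def)
      have "H z = 0"
        using xy by (simp add: z_def linear_between_diff[OF equivariantD(1)[OF eqH] X(1)])
      then have "h a z = g z"
        by (simp add: g_def)
      then have "?n z = z"
        using \<open>inj_on g X\<close> z by simp
      then have "(?n ^^ j) z = z" for j
        by (induction j) auto
      then show "x = y"
        using k[OF z] by (simp add: z_def)
    qed
    then have "\<exists>j\<in>J. inj_on (h j) X"
      using insert.IH insert.prems(1) by (simp add: H_def[abs_def])
    then show ?case
      by blast
  qed
qed

section \<open>Invariance of indecomposability under isomorphism\<close>

lemma rep_iso_subrepresentation:
  assumes "monoid_representation X \<rho>" "rep_iso X \<rho> Y \<rho>' \<phi>" "subrepresentation U X \<rho>"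
  shows "subrepresentation (\<phi> ` U) Y \<rho>'"
proof -
  have U: "U \<subseteq> X" "monoid_representation U \<rho>"
    using assms(3) by (auto simp: subrepresentation_def)
  have "equivariant U \<rho> Y \<rho>' \<phi>"
    using equivariant_subset[OF rep_isoD(1)[OF assms(2)] U(1)] U(1) rep_isoD(3)[OF assms(2)] by blast
  then show ?thesis
    using equivariant_image_subrepresentation U(2) rep_iso_monoid_representation[OF assms(1,2)] by blast
qed

lemma rep_iso_complementary:
  assumes "monoid_representation X \<rho>" "rep_iso X \<rho> Y \<rho>' \<phi>" "U \<subseteq> X" "W \<subseteq> X" "complementary U W X"
  shows "complementary (\<phi> ` U) (\<phi> ` W) Y"
  unfolding complementary_def
proof (intro conjI ballI)
  note X = monoid_representationD(1)[OF assms(1)] and \<phi> = rep_isoD[OF assms(2)]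
  note lin = equivariantD(1)[OF \<phi>(1)]
  have "\<phi> ` U \<inter> \<phi> ` W = \<phi> ` (U \<inter> W)"
    using inj_on_image_Int[OF \<phi>(4) assms(3,4)] by simp
  then show "\<phi> ` U \<inter> \<phi> ` W = {0}"
    using assms(5) linear_between_zero[OF lin X] by (simp add: complementary_def)
  fix y assume "y \<in> Y"
  then obtain x where x: "x \<in> X" "y = \<phi> x"
    using \<phi>(3) by blast
  then obtain u w where uw: "u \<in> U" "w \<in> W" "x = u + w"
    using assms(5) unfolding complementary_def by blast
  then have "y = \<phi> u + \<phi> w"
    using linear_betweenD(2)[OF lin] x(2) assms(3,4) by blast
  then show "\<exists>u\<in>\<phi> ` U. \<exists>w\<in>\<phi> ` W. y = u + w"
    using uw by blast
qed

text \<open>A splitting of \<open>Y\<close> is pulled back along the inverse isomorphism to a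
  splitting of \<open>X\<close>, one part of which is zero.\<close>

lemma rep_iso_indecomposable:
  assumes "indecomposable X \<rho>" "rep_iso X \<rho> Y \<rho>' \<phi>"
  shows "indecomposable Y \<rho>'"
proof -
  have rep: "monoid_representation X \<rho>" and "X \<noteq> {0}"
    using assms(1) by (auto simp: indecomposable_def)
  note X = monoid_representationD(1)[OF rep]
  have repY: "monoid_representation Y \<rho>'"
    by (rule rep_iso_monoid_representation[OF rep assms(2)])
  note Y = monoid_representationD(1)[OF repY]
  let ?\<psi> = "inv_into X \<phi>"
  have \<psi>: "rep_iso Y \<rho>' X \<rho> ?\<psi>"
    by (rule rep_iso_inv_into[OF rep assms(2)])
  have zero: "V = {0}" if "?\<psi> ` V = {0}" "subrepresentation V Y \<rho>'" for V
  proof -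
    have V: "V \<subseteq> Y" "0 \<in> V"
      using that(2) monoid_representationD(1) subspace_0 by (auto simp: subrepresentation_def)
    have "?\<psi> ` V = ?\<psi> ` {0}"
      using that(1) linear_between_zero[OF equivariantD(1)[OF rep_isoD(1)[OF \<psi>]] Y] by simp
    then show ?thesis
      using inj_on_image_eq_iff[OF rep_isoD(4)[OF \<psi>] V(1), of "{0}"] V by blast
  qed
  have "Y \<noteq> {0}"
  proof
    assume "Y = {0}"
    then have "X = {0}"
      using rep_isoD(3)[OF \<psi>] linear_between_zero[OF equivariantD(1)[OF rep_isoD(1)[OF \<psi>]] Y] by simp
    with \<open>X \<noteq> {0}\<close> show False ..
  qed
  moreover have "U = {0} \<or> W = {0}"
    if UW: "subrepresentation U Y \<rho>'" "subrepresentation W Y \<rho>'" "complementary U W Y" for U W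
  proof -
    have "U \<subseteq> Y" "W \<subseteq> Y"
      using UW by (auto simp: subrepresentation_def)
    then have "complementary (?\<psi> ` U) (?\<psi> ` W) X"
      by (rule rep_iso_complementary[OF repY \<psi> _ _ UW(3)])
    then have "?\<psi> ` U = {0} \<or> ?\<psi> ` W = {0}"
      using rep_iso_subrepresentation[OF repY \<psi> UW(1)] rep_iso_subrepresentation[OF repY \<psi> UW(2)]
        assms(1) unfolding indecomposable_iff by blast
    then show ?thesis
      using zero UW by blast
  qed
  ultimately show ?thesis
    using repY unfolding indecomposable_iff by blast
qed


section \<open>Transport of the endomorphism ring and its radical\<close>

lemma carrier_endo_ring:
  "\<alpha> \<in> carrier (endo_ring X \<rho>) \<longleftrightarrow> \<alpha> \<in> extensional X \<and> equivariant X \<rho> X \<rho> \<alpha>"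
  by (simp add: endo_ring_def)

lemma endo_ring_simps:
  "\<alpha> \<otimes>\<^bsub>endo_ring X \<rho>\<^esub> \<beta> = compose X \<alpha> \<beta>" "\<one>\<^bsub>endo_ring X \<rho>\<^esub> = (\<lambda>x\<in>X. x)"
  "\<zero>\<^bsub>endo_ring X \<rho>\<^esub> = (\<lambda>x\<in>X. 0)" "\<alpha> \<oplus>\<^bsub>endo_ring X \<rho>\<^esub> \<beta> = (\<lambda>x\<in>X. \<alpha> x + \<beta> x)"
  by (simp_all add: endo_ring_def)

lemma restrict_in_endo_ring:
  assumes "monoid_representation X \<rho>" "equivariant X \<rho> X \<rho> \<alpha>"
  shows "restrict \<alpha> X \<in> carrier (endo_ring X \<rho>)"
  using assms equivariant_cong[OF assms(1), of "restrict \<alpha> X" \<alpha>] by (simp add: carrier_endo_ring)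

lemma ring_endo_ring:
  assumes "monoid_representation X \<rho>"
  shows "ring (endo_ring X \<rho>)"
proof (intro ringI abelian_groupI monoidI)
  let ?R = "endo_ring X \<rho>"
  note restr = restrict_in_endo_ring[OF assms]
  show "\<one>\<^bsub>?R\<^esub> \<in> carrier ?R"
    unfolding endo_ring_simps by (intro restr equivariant_id)
  show "\<zero>\<^bsub>?R\<^esub> \<in> carrier ?R"
    unfolding endo_ring_simps by (intro restr equivariant_zero assms)
  fix \<alpha> assume \<alpha>: "\<alpha> \<in> carrier ?R"
  then have \<alpha>e: "\<alpha> \<in> extensional X" "equivariant X \<rho> X \<rho> \<alpha>"
    by (simp_all add: carrier_endo_ring)
  note \<alpha>X = equivariantD(2)[OF \<alpha>e(2)] and \<alpha>lin = equivariantD(1)[OF \<alpha>e(2)]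
  show "\<zero>\<^bsub>?R\<^esub> \<oplus>\<^bsub>?R\<^esub> \<alpha> = \<alpha>" "\<one>\<^bsub>?R\<^esub> \<otimes>\<^bsub>?R\<^esub> \<alpha> = \<alpha>" "\<alpha> \<otimes>\<^bsub>?R\<^esub> \<one>\<^bsub>?R\<^esub> = \<alpha>"
    using \<alpha>X \<alpha>e(1) unfolding endo_ring_simps compose_def
    by (auto intro!: extensionalityI[of _ X])
  show "\<exists>\<beta>\<in>carrier ?R. \<beta> \<oplus>\<^bsub>?R\<^esub> \<alpha> = \<zero>\<^bsub>?R\<^esub>"
  proof
    show "(\<lambda>x\<in>X. - \<alpha> x) \<in> carrier ?R"
      by (intro restr equivariant_uminus assms \<alpha>e(2))
    show "(\<lambda>x\<in>X. - \<alpha> x) \<oplus>\<^bsub>?R\<^esub> \<alpha> = \<zero>\<^bsub>?R\<^esub>"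
      unfolding endo_ring_simps by (auto intro!: extensionalityI[of _ X])
  qed
  fix \<beta> assume \<beta>: "\<beta> \<in> carrier ?R"
  then have \<beta>e: "\<beta> \<in> extensional X" "equivariant X \<rho> X \<rho> \<beta>"
    by (simp_all add: carrier_endo_ring)
  note \<beta>X = equivariantD(2)[OF \<beta>e(2)]
  show "\<alpha> \<oplus>\<^bsub>?R\<^esub> \<beta> \<in> carrier ?R"
    unfolding endo_ring_simps by (intro restr equivariant_add assms \<alpha>e(2) \<beta>e(2))
  show "\<alpha> \<otimes>\<^bsub>?R\<^esub> \<beta> \<in> carrier ?R"
    unfolding endo_ring_simps compose_def
    by (intro restr equivariant_compose[OF \<beta>e(2) \<alpha>e(2)])
  show "\<alpha> \<oplus>\<^bsub>?R\<^esub> \<beta> = \<beta> \<oplus>\<^bsub>?R\<^esub> \<alpha>"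
    unfolding endo_ring_simps by (auto simp: add.commute)
  fix \<gamma> assume \<gamma>: "\<gamma> \<in> carrier ?R"
  then have \<gamma>X: "\<gamma> x \<in> X" if "x \<in> X" for x
    using that equivariantD(2) by (auto simp: carrier_endo_ring)
  \<comment> \<open>Composing with \<gamma> on the left distributes over sums only because \<gamma>
    is additive; the other laws below hold pointwise.\<close>
  have *: "\<gamma> (x + y) = \<gamma> x + \<gamma> y" if "x \<in> X" "y \<in> X" for x y
    using that \<gamma> linear_betweenD(2) equivariantD(1) by (fastforce simp: carrier_endo_ring)
  show "\<alpha> \<oplus>\<^bsub>?R\<^esub> \<beta> \<oplus>\<^bsub>?R\<^esub> \<gamma> = \<alpha> \<oplus>\<^bsub>?R\<^esub> (\<beta> \<oplus>\<^bsub>?R\<^esub> \<gamma>)"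
    "\<alpha> \<otimes>\<^bsub>?R\<^esub> \<beta> \<otimes>\<^bsub>?R\<^esub> \<gamma> = \<alpha> \<otimes>\<^bsub>?R\<^esub> (\<beta> \<otimes>\<^bsub>?R\<^esub> \<gamma>)"
    "(\<alpha> \<oplus>\<^bsub>?R\<^esub> \<beta>) \<otimes>\<^bsub>?R\<^esub> \<gamma> = \<alpha> \<otimes>\<^bsub>?R\<^esub> \<gamma> \<oplus>\<^bsub>?R\<^esub> \<beta> \<otimes>\<^bsub>?R\<^esub> \<gamma>"
    "\<gamma> \<otimes>\<^bsub>?R\<^esub> (\<alpha> \<oplus>\<^bsub>?R\<^esub> \<beta>) = \<gamma> \<otimes>\<^bsub>?R\<^esub> \<alpha> \<oplus>\<^bsub>?R\<^esub> \<gamma> \<otimes>\<^bsub>?R\<^esub> \<beta>"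
    using \<alpha>X \<beta>X \<gamma>X unfolding endo_ring_simps compose_def
    by (auto simp: add.assoc * intro!: restrict_ext)
qed

lemma rep_iso_endo_ring:
  assumes "monoid_representation X \<rho>" "rep_iso X \<rho> Y \<rho>' \<phi>"
  shows "endo_ring X \<rho> \<simeq> endo_ring Y \<rho>'"
proof -
  let ?R = "endo_ring X \<rho>" and ?S = "endo_ring Y \<rho>'" and ?\<psi> = "inv_into X \<phi>"
  have repY: "monoid_representation Y \<rho>'"
    by (rule rep_iso_monoid_representation[OF assms])
  note X = monoid_representationD[OF assms(1)] and \<phi> = rep_isoD[OF assms(2)]
  note \<psi> = rep_isoD[OF rep_iso_inv_into[OF assms]]
  note \<phi>X = equivariantD(2)[OF \<phi>(1)] and \<psi>Y = equivariantD(2)[OF \<psi>(1)]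
  have \<psi>\<phi>: "?\<psi> (\<phi> x) = x" if "x \<in> X" for x
    using bij_betw_inv_into_left[OF \<phi>(2) that] .
  have \<phi>\<psi>: "\<phi> (?\<psi> y) = y" if "y \<in> Y" for y
    using bij_betw_inv_into_right[OF \<phi>(2) that] .
  \<comment> \<open>Conjugation by \<phi>, with \<open>G\<close> as its inverse. Restricting to
    \<open>Y\<close> keeps the result extensional, as membership in the carrier demands.\<close>
  define H where "H \<alpha> = (\<lambda>y\<in>Y. \<phi> (\<alpha> (?\<psi> y)))" for \<alpha>
  define G where "G \<beta> = (\<lambda>x\<in>X. ?\<psi> (\<beta> (\<phi> x)))" for \<beta>
  have H: "H \<alpha> \<in> carrier ?S" if "\<alpha> \<in> carrier ?R" for \<alpha>
  proof -
    have "equivariant X \<rho> X \<rho> \<alpha>"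
      using that by (simp add: carrier_endo_ring)
    from restrict_in_endo_ring[OF repY equivariant_compose[OF equivariant_compose[OF \<psi>(1) this] \<phi>(1)]]
    show ?thesis
      by (simp add: H_def)
  qed
  have G: "G \<beta> \<in> carrier ?R" if "\<beta> \<in> carrier ?S" for \<beta>
  proof -
    have "equivariant Y \<rho>' Y \<rho>' \<beta>"
      using that by (simp add: carrier_endo_ring)
    from restrict_in_endo_ring[OF assms(1) equivariant_compose[OF equivariant_compose[OF \<phi>(1) this] \<psi>(1)]]
    show ?thesis
      by (simp add: G_def)
  qed
  have RX: "\<alpha> x \<in> X" if "\<alpha> \<in> carrier ?R" "x \<in> X" for \<alpha> x
    using that equivariantD(2) by (auto simp: carrier_endo_ring)
  have SY: "\<beta> y \<in> Y" if "\<beta> \<in> carrier ?S" "y \<in> Y" for \<beta> y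
    using that equivariantD(2) by (auto simp: carrier_endo_ring)
  have "bij_betw H (carrier ?R) (carrier ?S)"
  proof (rule bij_betw_byWitness[where f' = G])
    show "\<forall>\<alpha>\<in>carrier ?R. G (H \<alpha>) = \<alpha>"
    proof
      fix \<alpha> assume \<alpha>: "\<alpha> \<in> carrier ?R"
      show "G (H \<alpha>) = \<alpha>"
        by (rule extensionalityI[of _ X])
          (use \<alpha> RX[OF \<alpha>] \<phi>X in \<open>auto simp: G_def H_def \<psi>\<phi> carrier_endo_ring\<close>)
    qed
    show "\<forall>\<beta>\<in>carrier ?S. H (G \<beta>) = \<beta>"
    proof
      fix \<beta> assume \<beta>: "\<beta> \<in> carrier ?S"
      show "H (G \<beta>) = \<beta>"
        by (rule extensionalityI[of _ Y])
          (use \<beta> SY[OF \<beta>] \<psi>Y in \<open>auto simp: G_def H_def \<phi>\<psi> carrier_endo_ring\<close>)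
    qed
  qed (use H G in auto)
  moreover have "H \<in> ring_hom ?R ?S"
  proof (rule ring_hom_memI)
    fix \<alpha> \<beta> assume \<alpha>: "\<alpha> \<in> carrier ?R" and \<beta>: "\<beta> \<in> carrier ?R"
    show "H (\<alpha> \<otimes>\<^bsub>?R\<^esub> \<beta>) = H \<alpha> \<otimes>\<^bsub>?S\<^esub> H \<beta>"
      unfolding endo_ring_simps compose_def H_def
      using RX[OF \<alpha>] RX[OF \<beta>] \<psi>Y \<phi>X by (auto simp: \<psi>\<phi> intro!: restrict_ext)
    show "H (\<alpha> \<oplus>\<^bsub>?R\<^esub> \<beta>) = H \<alpha> \<oplus>\<^bsub>?S\<^esub> H \<beta>"
      unfolding endo_ring_simps H_def
      using RX[OF \<alpha>] RX[OF \<beta>] \<psi>Y linear_betweenD(2)[OF equivariantD(1)[OF \<phi>(1)]]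
      by (auto intro!: restrict_ext)
  next
    show "H \<one>\<^bsub>?R\<^esub> = \<one>\<^bsub>?S\<^esub>"
      unfolding endo_ring_simps H_def using \<psi>Y by (auto simp: \<phi>\<psi> intro!: restrict_ext)
  qed (rule H)
  ultimately show ?thesis
    unfolding is_ring_iso_def ring_iso_def by blast
qed

section \<open>Left ideals, radical and quotient under ring isomorphisms\<close>

lemma additive_subgroup_ring_iso_image:
  assumes "ring R" "ring S" "h \<in> ring_iso R S" "additive_subgroup I R"
  shows "additive_subgroup (h ` I) S"
proof -
  interpret R: ring R by fact
  interpret S: ring S by fact
  have "h \<in> hom (add_monoid R) (add_monoid S)"
    using assms(3) by (auto simp: ring_iso_def ring_hom_def hom_def)
  then interpret h: group_hom "add_monoid R" "add_monoid S" h
    by unfold_locales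
  show ?thesis
    using h.subgroup_img_is_subgroup additive_subgroup.a_subgroup[OF assms(4)]
    by (intro additive_subgroup.intro) blast
qed

text \<open>Surjectivity is essential: every multiplier in \<open>S\<close> has the form
  \<open>h b\<close>, so closure under multiplication can be checked in \<open>R\<close>.\<close>

lemma left_ideal_ring_iso_image:
  assumes "ring R" "ring S" "h \<in> ring_iso R S" "left_ideal I R"
  shows "left_ideal (h ` I) S"
proof -
  have I: "additive_subgroup I R" "\<And>a x. a \<in> carrier R \<Longrightarrow> x \<in> I \<Longrightarrow> a \<otimes>\<^bsub>R\<^esub> x \<in> I"
    using assms(4) by (auto simp: left_ideal_def)
  have sub: "I \<subseteq> carrier R"
    by (rule additive_subgroup.a_subset[OF I(1)])
  have h: "h \<in> ring_hom R S" "h ` carrier R = carrier S"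
    using assms(3) by (auto simp: ring_iso_def bij_betw_def)
  have "a \<otimes>\<^bsub>S\<^esub> x \<in> h ` I" if ax: "a \<in> carrier S" "x \<in> h ` I" for a x
  proof -
    obtain b y where ab: "b \<in> carrier R" "a = h b" "y \<in> I" "x = h y"
      using ax h(2) by blast
    then have "a \<otimes>\<^bsub>S\<^esub> x = h (b \<otimes>\<^bsub>R\<^esub> y)"
      using ring_hom_mult[OF h(1)] sub by auto
    then show ?thesis
      using I(2) ab by blast
  qed
  then show ?thesis
    using additive_subgroup_ring_iso_image[OF assms(1-3) I(1)] by (simp add: left_ideal_def)
qed

lemma maximal_left_ideal_ring_iso_image:
  assumes "ring R" "ring S" "h \<in> ring_iso R S" "maximal_left_ideal I R"
  shows "maximal_left_ideal (h ` I) S"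
proof -
  define g where "g = inv_into (carrier R) h"
  have g: "g \<in> ring_iso S R"
    unfolding g_def by (rule ring_iso_set_sym[OF assms(1,3)])
  have bij: "bij_betw h (carrier R) (carrier S)"
    using assms(3) by (simp add: ring_iso_def)
  have sub: "J \<subseteq> carrier Q" if "left_ideal J Q" for J and Q :: "('x, 'y) ring_scheme"
    using that additive_subgroup.a_subset by (auto simp: left_ideal_def)
  have I: "left_ideal I R" "I \<noteq> carrier R" "\<And>J. left_ideal J R \<Longrightarrow> I \<subseteq> J \<Longrightarrow> J = I \<or> J = carrier R"
    using assms(4) by (auto simp: maximal_left_ideal_def)
  have gh: "g ` h ` J = J" if "J \<subseteq> carrier R" for J
    using that bij unfolding g_def by (simp add: bij_betw_def)
  have hg: "h ` g ` J = J" if "J \<subseteq> carrier S" for J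
    using that bij unfolding g_def by (simp add: bij_betw_def image_inv_into_cancel)
  have hR: "h ` carrier R = carrier S" and gS: "g ` carrier S = carrier R"
    using bij gh[of "carrier R"] by (simp_all add: bij_betw_def)
  show ?thesis
    unfolding maximal_left_ideal_def
  proof (intro conjI allI impI)
    show "left_ideal (h ` I) S"
      by (rule left_ideal_ring_iso_image[OF assms(1-3) I(1)])
    show "h ` I \<noteq> carrier S"
      using I(2) gh[OF sub[OF I(1)]] gS by metis
    fix J assume "left_ideal J S \<and> h ` I \<subseteq> J"
    then have J: "left_ideal J S" "h ` I \<subseteq> J"
      by auto
    have "left_ideal (g ` J) R"
      by (rule left_ideal_ring_iso_image[OF assms(2,1) g J(1)])
    moreover have "I \<subseteq> g ` J"
      using image_mono[OF J(2), of g] gh[OF sub[OF I(1)]] by simp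
    ultimately have "g ` J = I \<or> g ` J = carrier R"
      by (rule I(3))
    then show "J = h ` I \<or> J = carrier S"
      using hg[OF sub[OF J(1)]] hR by metis
  qed
qed

lemma radical_ring_iso_image_subset:
  assumes "ring R" "ring S" "h \<in> ring_iso R S"
  shows "h ` radical R \<subseteq> radical S"
proof
  define g where "g = inv_into (carrier R) h"
  have g: "g \<in> ring_iso S R"
    unfolding g_def by (rule ring_iso_set_sym[OF assms(1,3)])
  have bij: "bij_betw h (carrier R) (carrier S)"
    using assms(3) by (simp add: ring_iso_def)
  fix y assume "y \<in> h ` radical R"
  then obtain x where x: "x \<in> radical R" "y = h x"
    by blast
  have xR: "x \<in> carrier R"
    using x(1) by (simp add: radical_def)
  have "y \<in> J" if J: "maximal_left_ideal J S" for J
  proof -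
    have "maximal_left_ideal (g ` J) R"
      by (rule maximal_left_ideal_ring_iso_image[OF assms(2,1) g J])
    then have "x \<in> g ` J"
      using x(1) by (simp add: radical_def)
    then obtain z where z: "z \<in> J" "x = g z"
      by blast
    have "z \<in> carrier S"
      using J z(1) additive_subgroup.a_subset by (auto simp: maximal_left_ideal_def left_ideal_def)
    then have "h (g z) = z"
      unfolding g_def using bij by (simp add: bij_betw_def f_inv_into_f)
    then show ?thesis
      using z x(2) by simp
  qed
  then show "y \<in> radical S"
    using x(2) bij xR by (auto simp: radical_def bij_betw_def)
qed

lemma radical_ring_iso_image:
  assumes "ring R" "ring S" "h \<in> ring_iso R S"
  shows "h ` radical R = radical S"
proof
  show "h ` radical R \<subseteq> radical S"
    by (rule radical_ring_iso_image_subset[OF assms])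
  let ?g = "inv_into (carrier R) h"
  have bij: "bij_betw h (carrier R) (carrier S)"
    using assms(3) by (simp add: ring_iso_def)
  have "?g ` radical S \<subseteq> radical R"
    by (rule radical_ring_iso_image_subset[OF assms(2,1) ring_iso_set_sym[OF assms(1,3)]])
  then have "h ` ?g ` radical S \<subseteq> h ` radical R"
    by (rule image_mono)
  moreover have "h ` ?g ` radical S = radical S"
    using bij by (intro image_inv_into_cancel) (auto simp: bij_betw_def radical_def)
  ultimately show "radical S \<subseteq> h ` radical R"
    by simp
qed

text \<open>The radical is not known here to be two-sided, so the cosets are transported as sets instead of
  through an induced homomorphism.\<close>

lemma FactRing_ring_iso_image:
  assumes "ring R" "h \<in> ring_iso R S" "I \<subseteq> carrier R"
  shows "(R Quot I) \<simeq> (S Quot (h ` I))"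
proof -
  interpret R: ring R by fact
  have bij: "bij_betw h (carrier R) (carrier S)" and hom: "h \<in> ring_hom R S"
    using assms(2) by (simp_all add: ring_iso_def)
  note mult = ring_hom_mult[OF hom] and add = ring_hom_add[OF hom]
  have coset: "h ` (I +>\<^bsub>R\<^esub> a) = h ` I +>\<^bsub>S\<^esub> h a" if "a \<in> carrier R" for a
    using that assms(3) add unfolding a_r_coset_def' by (auto simp: image_UN image_iff subset_iff)
  have coset_sub: "I +>\<^bsub>R\<^esub> a \<subseteq> carrier R" if "a \<in> carrier R" for a
    using that assms(3) unfolding a_r_coset_def' by auto
  have carr: "carrier (S Quot (h ` I)) = image h ` carrier (R Quot I)"
    using bij coset by (auto simp: FactRing_def A_RCOSETS_def' bij_betw_def image_UN
        simp flip: coset bij_betw_imp_surj_on[OF bij])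
  have Qsub: "A \<subseteq> carrier R" if "A \<in> carrier (R Quot I)" for A
    using that coset_sub by (auto simp: FactRing_def A_RCOSETS_def')
  have "inj_on (image h) (carrier (R Quot I))"
    using Qsub bij by (intro inj_onI) (metis bij_betw_def inj_on_image_eq_iff)
  then have "bij_betw (image h) (carrier (R Quot I)) (carrier (S Quot (h ` I)))"
    using carr by (simp add: bij_betw_def)
  moreover have "image h \<in> ring_hom (R Quot I) (S Quot (h ` I))"
  proof (rule ring_hom_memI)
    fix A assume A: "A \<in> carrier (R Quot I)"
    then show "h ` A \<in> carrier (S Quot (h ` I))"
      using carr by blast
    fix B assume B: "B \<in> carrier (R Quot I)"
    note sub = Qsub[OF A] Qsub[OF B]
    \<comment> \<open>The product of two cosets is a union over all representatives, and images
      commute with unions. No independence of the chosen representative enters.\<close>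
    have "h ` (\<Union>a\<in>A. \<Union>b\<in>B. I +>\<^bsub>R\<^esub> a \<otimes>\<^bsub>R\<^esub> b) = (\<Union>a\<in>A. \<Union>b\<in>B. h ` (I +>\<^bsub>R\<^esub> a \<otimes>\<^bsub>R\<^esub> b))"
      by (simp add: image_UN)
    also have "\<dots> = (\<Union>a\<in>A. \<Union>b\<in>B. h ` I +>\<^bsub>S\<^esub> h a \<otimes>\<^bsub>S\<^esub> h b)"
      using sub by (intro SUP_cong refl) (simp add: coset mult subset_iff)
    also have "\<dots> = (\<Union>a\<in>h ` A. \<Union>b\<in>h ` B. h ` I +>\<^bsub>S\<^esub> a \<otimes>\<^bsub>S\<^esub> b)"
      by simp
    finally show "h ` (A \<otimes>\<^bsub>R Quot I\<^esub> B) = h ` A \<otimes>\<^bsub>S Quot (h ` I)\<^esub> h ` B"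
      by (simp add: FactRing_def rcoset_mult_def)
    have "h ` (\<Union>a\<in>A. \<Union>b\<in>B. {a \<oplus>\<^bsub>R\<^esub> b}) = (\<Union>a\<in>A. \<Union>b\<in>B. {h (a \<oplus>\<^bsub>R\<^esub> b)})"
      by (simp add: image_UN)
    also have "\<dots> = (\<Union>a\<in>A. \<Union>b\<in>B. {h a \<oplus>\<^bsub>S\<^esub> h b})"
      using sub by (intro SUP_cong refl) (simp add: add subset_iff)
    also have "\<dots> = (\<Union>a\<in>h ` A. \<Union>b\<in>h ` B. {a \<oplus>\<^bsub>S\<^esub> b})"
      by simp
    finally show "h ` (A \<oplus>\<^bsub>R Quot I\<^esub> B) = h ` A \<oplus>\<^bsub>S Quot (h ` I)\<^esub> h ` B"
      by (simp add: FactRing_def set_add_def')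
  next
    show "h ` \<one>\<^bsub>R Quot I\<^esub> = \<one>\<^bsub>S Quot (h ` I)\<^esub>"
      using coset[of "\<one>\<^bsub>R\<^esub>"] ring_hom_one[OF hom] by (simp add: FactRing_def)
  qed
  ultimately show ?thesis
    unfolding is_ring_iso_def ring_iso_def by blast
qed

lemma rep_iso_absolutely_indecomposable:
  assumes "absolutely_indecomposable X \<rho>" "rep_iso X \<rho> Y \<rho>' \<phi>"
  shows "absolutely_indecomposable Y \<rho>'"
proof -
  let ?R = "endo_ring X \<rho>" and ?S = "endo_ring Y \<rho>'"
  have ind: "indecomposable X \<rho>" and iso: "(?R Quot radical ?R) \<simeq> real_ring"
    using assms(1) by (auto simp: absolutely_indecomposable_def)
  then have rep: "monoid_representation X \<rho>"
    by (simp add: indecomposable_def)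
  then have repY: "monoid_representation Y \<rho>'"
    by (rule rep_iso_monoid_representation[OF _ assms(2)])
  note rings = ring_endo_ring[OF rep] ring_endo_ring[OF repY]
  obtain h where "h \<in> ring_iso ?R ?S"
    using rep_iso_endo_ring[OF rep assms(2)] unfolding is_ring_iso_def by blast
  \<comment> \<open>With the inverse isomorphism the map of quotients starts at the quotient for
    \<open>Y\<close> and composes directly with \<open>iso\<close>. No map between quotients, which
    are not known to be rings, has to be inverted.\<close>
  then have g: "inv_into (carrier ?R) h \<in> ring_iso ?S ?R" (is "?g \<in> _")
    by (rule ring_iso_set_sym[OF rings(1)])
  have "(?S Quot radical ?S) \<simeq> (?R Quot (?g ` radical ?S))"
    by (rule FactRing_ring_iso_image[OF rings(2) g]) (simp add: radical_def)
  then have "(?S Quot radical ?S) \<simeq> (?R Quot radical ?R)"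
    unfolding radical_ring_iso_image[OF rings(2,1) g] .
  then have "(?S Quot radical ?S) \<simeq> real_ring"
    using iso by (rule ring_iso_trans)
  then show ?thesis
    using rep_iso_indecomposable[OF ind assms(2)] by (simp add: absolutely_indecomposable_def)
qed


section \<open>Conjugation of reduced problems\<close>

lemma C_on_cong:
  assumes "C_on k S f" "\<And>x. x \<in> S \<Longrightarrow> f x = g x"
  shows "C_on k S g"
proof (cases k)
  case 0
  then show ?thesis
    using assms by (simp cong: continuous_on_cong)
next
  case (Suc n)
  then obtain f' where f': "\<And>x. x \<in> S \<Longrightarrow> (f has_derivative f' x) (at x within S)"
      "\<And>v. v \<in> S \<Longrightarrow> C_on n S (\<lambda>x. f' x v)"
    using assms(1) by auto
  have "(g has_derivative f' x) (at x within S)" if "x \<in> S" for x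
    using has_derivative_transform[OF that _ f'(1)[OF that]] assms(2) by simp
  then show ?thesis
    using f'(2) Suc by auto
qed

text \<open>By the chain rule, the derivative in direction \<open>v\<close> is
  \<open>B (f' (A x) (A v))\<close>. This has the same shape with \<open>f\<close> replaced by the
  directional derivative along \<open>A v\<close>, and \<open>A v\<close> lies in \<open>S\<close>,
  so the induction runs over arbitrary \<open>f\<close>.\<close>

lemma C_on_linear_compose:
  fixes A :: "'a::euclidean_space \<Rightarrow> 'b::euclidean_space" and B :: "'c::euclidean_space \<Rightarrow> 'd::euclidean_space"
  assumes "linear A" "linear B" "A ` T \<subseteq> S" "C_on k S f"
  shows "C_on k T (\<lambda>x. B (f (A x)))"
  using assms(4)
proof (induction k arbitrary: f)
  case 0
  then have "continuous_on S f"
    by simp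
  then have "continuous_on T (\<lambda>x. f (A x))"
    using linear_continuous_on[OF linear_conv_bounded_linear[THEN iffD1, OF assms(1)]] assms(3)
    by (rule continuous_on_compose2)
  then have "continuous_on T (\<lambda>x. B (f (A x)))"
    by (rule continuous_on_compose2[OF linear_continuous_on[OF
          linear_conv_bounded_linear[THEN iffD1, OF assms(2)], of UNIV]]) simp
  then show ?case
    by simp
next
  case (Suc k)
  then obtain f' where f': "\<And>x. x \<in> S \<Longrightarrow> (f has_derivative f' x) (at x within S)"
      "\<And>v. v \<in> S \<Longrightarrow> C_on k S (\<lambda>x. f' x v)"
    by auto
  note derA = bounded_linear_imp_has_derivative[OF linear_conv_bounded_linear[THEN iffD1, OF assms(1)]]
  note blB = linear_conv_bounded_linear[THEN iffD1, OF assms(2)]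
  have "((\<lambda>x. B (f (A x))) has_derivative (\<lambda>v. B (f' (A x) (A v)))) (at x within T)" if "x \<in> T" for x
  proof (intro bounded_linear.has_derivative[OF blB])
    have "(f has_derivative f' (A x)) (at (A x) within A ` T)"
      using f'(1)[of "A x"] assms(3) that by (blast intro: has_derivative_subset)
    from has_derivative_in_compose[OF derA this]
    show "((\<lambda>x. f (A x)) has_derivative (\<lambda>v. f' (A x) (A v))) (at x within T)" .
  qed
  moreover have "C_on k T (\<lambda>x. B (f' (A x) (A v)))" if "v \<in> T" for v
    using Suc.IH[OF f'(2)[of "A v"]] assms(3) that by blast
  ultimately show ?case
    by (auto intro!: exI[of _ "\<lambda>x v. B (f' (A x) (A v))"])
qed

lemma C_on_const: "C_on k S (\<lambda>x. c)"
proof (induction k arbitrary: c)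
  case (Suc k)
  show ?case
    using Suc[of 0] by (auto intro!: exI[of _ "\<lambda>_ _. 0"])
qed simp

lemma smooth_on_linear:
  assumes "linear f"
  shows "smooth_on S f"
  unfolding smooth_on_def
proof
  note bl = linear_conv_bounded_linear[THEN iffD1, OF assms]
  show "C_on k S f" for k
  proof (cases k)
    case (Suc n)
    then show ?thesis
      using bounded_linear_imp_has_derivative[OF bl] C_on_const by (auto intro!: exI[of _ "\<lambda>_. f"])
  qed (simp add: linear_continuous_on[OF bl])
qed

lemma rep_iso_linear_extensions:
  assumes "monoid_representation X \<rho>" "rep_iso X \<rho> Y \<rho>' \<phi>"
  obtains \<Phi> \<Psi> where "linear \<Phi>" "\<And>x. x \<in> X \<Longrightarrow> \<Phi> x = \<phi> x"
    and "linear \<Psi>" "\<And>y. y \<in> Y \<Longrightarrow> \<Psi> y = inv_into X \<phi> y"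
proof -
  note X = monoid_representationD(1)[OF assms(1)]
  note Y = monoid_representationD(1)[OF rep_iso_monoid_representation[OF assms]]
  obtain \<Phi> where \<Phi>: "linear \<Phi>" "\<And>x. x \<in> X \<Longrightarrow> \<Phi> x = \<phi> x"
    using linear_between_extend[OF equivariantD(1)[OF rep_isoD(1)[OF assms(2)]] X] by blast
  obtain \<Psi> where \<Psi>: "linear \<Psi>" "\<And>y. y \<in> Y \<Longrightarrow> \<Psi> y = inv_into X \<phi> y"
    using linear_between_extend[OF equivariantD(1)[OF rep_isoD(1)[OF rep_iso_inv_into[OF assms]]] Y]
    by blast
  from \<Phi> \<Psi> show thesis
    by (rule that)
qed

lemma has_eigenvalue_conjugate:
  assumes "linear_between X Y \<phi>" "subspace X" "inj_on \<phi> X"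
    and "\<And>x. x \<in> X \<Longrightarrow> E (\<phi> x) = \<phi> (D x)" and "has_eigenvalue X D \<mu>"
  shows "has_eigenvalue Y E \<mu>"
proof -
  obtain x y where xy: "x \<in> X" "y \<in> X" "x \<noteq> 0 \<or> y \<noteq> 0"
      "D x = Re \<mu> *\<^sub>R x - Im \<mu> *\<^sub>R y" "D y = Im \<mu> *\<^sub>R x + Re \<mu> *\<^sub>R y"
    using assms(5) unfolding has_eigenvalue_def by blast
  note lin = linear_betweenD[OF assms(1)] linear_between_diff[OF assms(1,2)]
  note mem = subspace_mul[OF assms(2)]
  have "\<phi> x \<noteq> 0 \<or> \<phi> y \<noteq> 0"
    using xy(1-3) inj_onD[OF assms(3), of _ 0] linear_between_zero[OF assms(1,2)] subspace_0[OF assms(2)]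
    by metis
  moreover have "E (\<phi> x) = Re \<mu> *\<^sub>R \<phi> x - Im \<mu> *\<^sub>R \<phi> y" "E (\<phi> y) = Im \<mu> *\<^sub>R \<phi> x + Re \<mu> *\<^sub>R \<phi> y"
    using xy mem by (simp_all add: assms(4) lin)
  ultimately show ?thesis
    unfolding has_eigenvalue_def using xy(1,2) lin(1) by blast
qed

text \<open>The component of \<open>f\<close> orthogonal to \<open>U\<close> vanishes on
  \<open>U\<close>, and so does its derivative along \<open>U\<close>. This is needed because an
  extension of \<phi> agrees with \<phi> only on \<open>U\<close>, so \<open>D u\<close> must lie
  there before \<phi> can be applied.\<close>

lemma has_derivative_subspace_range:
  fixes U :: "'a::euclidean_space set"
  assumes "(f has_derivative D) (at 0 within U)" "subspace U" "\<And>u. u \<in> U \<Longrightarrow> f u \<in> U" "u \<in> U"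
  shows "D u \<in> U"
proof -
  have span: "span U = U"
    using assms(2) by simp
  obtain y z where yz: "y \<in> U" "\<And>w. w \<in> U \<Longrightarrow> orthogonal z w" "D u = y + z"
    using orthogonal_subspace_decomp_exists[of U "D u"] unfolding span by metis
  have "linear D"
    using assms(1) has_derivative_linear by blast
  \<comment> \<open>Restricting to the line through \<open>u\<close> gives a derivative in one real
    variable at an interior point, where it is unique.\<close>
  have "(\<lambda>t. t *\<^sub>R u) ` UNIV \<subseteq> U"
    using assms(2,4) by (auto simp: subspace_mul)
  then have "(f has_derivative D) (at (0 *\<^sub>R u) within (\<lambda>t. t *\<^sub>R u) ` UNIV)"
    using has_derivative_subset[OF assms(1)] by simp
  with has_derivative_scaleR_left[OF has_derivative_ident]
  have "((\<lambda>t. f (t *\<^sub>R u)) has_derivative (\<lambda>t. D (t *\<^sub>R u))) (at 0)"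
    by (rule has_derivative_in_compose)
  then have "((\<lambda>t. z \<bullet> f (t *\<^sub>R u)) has_derivative (\<lambda>t. z \<bullet> D (t *\<^sub>R u))) (at 0)"
    by (rule has_derivative_inner_right)
  moreover have "z \<bullet> f (t *\<^sub>R u) = 0" for t
    using yz(2) assms(2-4) by (simp add: subspace_mul orthogonal_def)
  ultimately have "((\<lambda>t. 0) has_derivative (\<lambda>t. z \<bullet> D (t *\<^sub>R u))) (at 0)"
    by simp
  then have "(\<lambda>t. z \<bullet> D (t *\<^sub>R u)) = (\<lambda>t :: real. 0)"
    by (rule has_derivative_unique) simp
  from fun_cong[OF this, of 1] have "z \<bullet> D u = 0"
    by simp
  then have "z = 0"
    using yz(2)[OF yz(1)] by (simp add: yz(3) inner_add_right orthogonal_def)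
  with yz show ?thesis
    by simp
qed

lemma conjugate_in_reduced_problems:
  fixes U :: "'a::euclidean_space set" and W :: "'b::euclidean_space set"
  assumes "monoid_representation U \<rho>" "rep_iso U \<rho> W \<rho>' \<phi>" "r \<in> reduced_problems U \<rho>"
  shows "conjugate \<phi> U W r \<in> reduced_problems W \<rho>'"
proof -
  let ?\<psi> = "inv_into U \<phi>" and ?q = "conjugate \<phi> U W r"
  note U = monoid_representationD[OF assms(1)] and \<phi> = rep_isoD[OF assms(2)]
  note W = monoid_representationD[OF rep_iso_monoid_representation[OF assms(1,2)]]
  note \<psi> = rep_isoD[OF rep_iso_inv_into[OF assms(1,2)]]
  note \<phi>e = equivariantD[OF \<phi>(1)] and \<psi>e = equivariantD[OF \<psi>(1)]
  have \<phi>\<psi>: "\<phi> (?\<psi> w) = w" if "w \<in> W" for w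
    using bij_betw_inv_into_right[OF \<phi>(2) that] .
  have \<psi>\<phi>: "?\<psi> (\<phi> u) = u" if "u \<in> U" for u
    using bij_betw_inv_into_left[OF \<phi>(2) that] .
  have r: "r \<in> U \<times> UNIV \<rightarrow>\<^sub>E U" "smooth_on (U \<times> UNIV) r" "r (0, 0) = 0"
      "\<And>\<sigma> u l. u \<in> U \<Longrightarrow> r (\<rho> \<sigma> u, l) = \<rho> \<sigma> (r (u, l))"
    using assms(3) by (auto simp: reduced_problems_def)
  obtain D where D: "((\<lambda>u. r (u, 0)) has_derivative D) (at 0 within U)"
      "{\<mu>. has_eigenvalue U D \<mu>} = {0}"
    using assms(3) by (auto simp: reduced_problems_def)
  have rU: "r (u, l) \<in> U" if "u \<in> U" for u l
    using r(1) that by (auto simp: PiE_iff)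
  have q: "?q (w, l) = \<phi> (r (?\<psi> w, l))" if "w \<in> W" for w l
    using that by (simp add: conjugate_def)
  obtain \<Phi> \<Psi> where \<Phi>: "linear \<Phi>" "\<And>x. x \<in> U \<Longrightarrow> \<Phi> x = \<phi> x"
    and \<Psi>: "linear \<Psi>" "\<And>y. y \<in> W \<Longrightarrow> \<Psi> y = ?\<psi> y"
    using rep_iso_linear_extensions[OF assms(1,2)] by blast
  have \<Psi>W: "\<Psi> ` W \<subseteq> U"
    using \<Psi>(2) \<psi>e(2) by auto
  \<comment> \<open>On \<open>W\<close> the conjugated family is a composite of \<open>r\<close>
    with globally linear maps; smoothness and the derivative are obtained for that composite and
    then transferred.\<close>
  have q_eq: "\<Phi> (r (\<Psi> w, l)) = ?q (w, l)" if "w \<in> W" for w l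
    using that q \<Psi>(2) \<Phi>(2) rU \<psi>e(2) by simp
  have zero: "?\<psi> 0 = 0" "\<phi> 0 = 0"
    by (rule linear_between_zero[OF \<psi>e(1) W(1)], rule linear_between_zero[OF \<phi>e(1) U(1)])
  note zW = subspace_0[OF W(1)]
  have "?q \<in> W \<times> UNIV \<rightarrow>\<^sub>E W"
    using q \<phi>e(2) rU \<psi>e(2) by (auto simp: PiE_iff) (simp add: conjugate_def extensional_def)
  moreover have "smooth_on (W \<times> UNIV) ?q"
    unfolding smooth_on_def
  proof
    fix k
    have "C_on k (U \<times> UNIV) r"
      using r(2) by (simp add: smooth_on_def)
    moreover have "linear (\<lambda>x :: 'b \<times> real. (\<Psi> (fst x), snd x))"
      by (rule linearI) (simp_all add: linear_add[OF \<Psi>(1)] linear_scale[OF \<Psi>(1)])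
    moreover have "(\<lambda>x :: 'b \<times> real. (\<Psi> (fst x), snd x)) ` (W \<times> UNIV) \<subseteq> U \<times> UNIV"
      using \<Psi>W by auto
    ultimately have "C_on k (W \<times> UNIV) (\<lambda>x. \<Phi> (r (\<Psi> (fst x), snd x)))"
      by (intro C_on_linear_compose[OF _ \<Phi>(1)])
    then show "C_on k (W \<times> UNIV) ?q"
      by (rule C_on_cong) (auto simp: q_eq)
  qed
  moreover have "?q (\<rho>' \<sigma> w, l) = \<rho>' \<sigma> (?q (w, l))" if "w \<in> W" for \<sigma> w l
    using that by (simp add: q W(3) \<psi>e(2,3) r(4) \<phi>e(3) rU)
  moreover have "?q (0, 0) = 0"
    using q[OF zW] by (simp add: zero r(3))
  moreover have "((\<lambda>w. ?q (w, 0)) has_derivative (\<lambda>w. \<Phi> (D (\<Psi> w)))) (at 0 within W)"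
  proof -
    note bl = linear_conv_bounded_linear[THEN iffD1]
    have "((\<lambda>u. r (u, 0)) has_derivative D) (at (\<Psi> 0) within \<Psi> ` W)"
      using has_derivative_subset[OF D(1) \<Psi>W] by (simp add: linear_0[OF \<Psi>(1)])
    from has_derivative_in_compose[OF bounded_linear_imp_has_derivative[OF bl[OF \<Psi>(1)]] this]
    have "((\<lambda>w. \<Phi> (r (\<Psi> w, 0))) has_derivative (\<lambda>w. \<Phi> (D (\<Psi> w)))) (at 0 within W)"
      by (rule bounded_linear.has_derivative[OF bl[OF \<Phi>(1)]])
    then show ?thesis
      by (rule has_derivative_transform[OF zW, rotated]) (simp add: q_eq)
  qed
  moreover have "{\<mu>. has_eigenvalue W (\<lambda>w. \<Phi> (D (\<Psi> w))) \<mu>} = {0}"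
  proof -
    \<comment> \<open>With \<open>D u\<close> in \<open>U\<close>, the two derivatives are
      intertwined by \<phi> and by its inverse, so eigenvalues pass in both directions.\<close>
    have DU: "D u \<in> U" if "u \<in> U" for u
      by (rule has_derivative_subspace_range[OF D(1) U(1) rU that])
    have "has_eigenvalue W (\<lambda>w. \<Phi> (D (\<Psi> w))) \<mu>" if "has_eigenvalue U D \<mu>" for \<mu>
      by (rule has_eigenvalue_conjugate[OF \<phi>e(1) U(1) \<phi>(4) _ that])
        (simp add: \<Psi>(2) \<phi>e(2) \<psi>\<phi> \<Phi>(2) DU)
    moreover have "has_eigenvalue U D \<mu>" if "has_eigenvalue W (\<lambda>w. \<Phi> (D (\<Psi> w))) \<mu>" for \<mu>
      by (rule has_eigenvalue_conjugate[OF \<psi>e(1) W(1) \<psi>(4) _ that])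
        (simp add: \<Psi>(2) \<psi>e(2) \<psi>\<phi> \<Phi>(2) DU)
    ultimately show ?thesis
      using D(2) by blast
  qed
  ultimately show ?thesis
    unfolding reduced_problems_def by blast
qed

text \<open>Conjugation by the inverse isomorphism undoes conjugation by \<phi> on extensional
  families, and both preserve the class of reduced problems.\<close>

lemma reduced_problems_equivalentI:
  fixes U :: "'a::euclidean_space set" and W :: "'b::euclidean_space set"
  assumes "monoid_representation U \<rho>" "rep_isomorphic U \<rho> W \<rho>'"
  shows "reduced_problems_equivalent U \<rho> W \<rho>'"
proof -
  obtain \<phi> where \<phi>: "rep_iso U \<rho> W \<rho>' \<phi>"
    using assms(2) unfolding rep_isomorphic_def by blast
  let ?\<psi> = "inv_into U \<phi>"
  have repW: "monoid_representation W \<rho>'" and \<psi>: "rep_iso W \<rho>' U \<rho> ?\<psi>"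
    by (rule rep_iso_monoid_representation[OF assms(1) \<phi>], rule rep_iso_inv_into[OF assms(1) \<phi>])
  note \<phi>b = rep_isoD(2)[OF \<phi>] and \<psi>b = rep_isoD(2)[OF \<psi>]
  have \<phi>U: "\<phi> u \<in> W" "?\<psi> (\<phi> u) = u" "inv_into W ?\<psi> u = \<phi> u" if "u \<in> U" for u
    using that bij_betwE[OF \<phi>b] bij_betw_inv_into_left[OF \<phi>b that] bij_betw_inv_into_left[OF \<psi>b, of "\<phi> u"]
    by auto
  have \<psi>W: "?\<psi> w \<in> U" "\<phi> (?\<psi> w) = w" if "w \<in> W" for w
    using that bij_betwE[OF \<psi>b] bij_betw_inv_into_right[OF \<phi>b that] by auto
  have "bij_betw (conjugate \<phi> U W) (reduced_problems U \<rho>) (reduced_problems W \<rho>')"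
  proof (rule bij_betw_byWitness[where f' = "conjugate ?\<psi> W U"])
    show "\<forall>r\<in>reduced_problems U \<rho>. conjugate ?\<psi> W U (conjugate \<phi> U W r) = r"
    proof
      fix r assume "r \<in> reduced_problems U \<rho>"
      then have r: "r \<in> U \<times> UNIV \<rightarrow>\<^sub>E U"
        by (simp add: reduced_problems_def)
      show "conjugate ?\<psi> W U (conjugate \<phi> U W r) = r"
      proof (rule extensionalityI[of _ "U \<times> UNIV"])
        fix x assume "x \<in> U \<times> (UNIV :: real set)"
        then obtain u l where x: "x = (u, l)" "u \<in> U"
          by auto
        then have "r (u, l) \<in> U"
          using r by (auto simp: PiE_iff)
        then show "conjugate ?\<psi> W U (conjugate \<phi> U W r) x = r x"
          using x by (simp add: conjugate_def \<phi>U)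
      qed (use r in \<open>auto simp: conjugate_def PiE_iff\<close>)
    qed
    show "\<forall>q\<in>reduced_problems W \<rho>'. conjugate \<phi> U W (conjugate ?\<psi> W U q) = q"
    proof
      fix q assume "q \<in> reduced_problems W \<rho>'"
      then have q: "q \<in> W \<times> UNIV \<rightarrow>\<^sub>E W"
        by (simp add: reduced_problems_def)
      show "conjugate \<phi> U W (conjugate ?\<psi> W U q) = q"
      proof (rule extensionalityI[of _ "W \<times> UNIV"])
        fix x assume "x \<in> W \<times> (UNIV :: real set)"
        then obtain w l where x: "x = (w, l)" "w \<in> W"
          by auto
        then have "q (w, l) \<in> W"
          using q by (auto simp: PiE_iff)
        then show "conjugate \<phi> U W (conjugate ?\<psi> W U q) x = q x"
          using x by (simp add: conjugate_def \<phi>U \<psi>W)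
      qed (use q in \<open>auto simp: conjugate_def PiE_iff\<close>)
    qed
    show "conjugate \<phi> U W ` reduced_problems U \<rho> \<subseteq> reduced_problems W \<rho>'"
      using conjugate_in_reduced_problems[OF assms(1) \<phi>] by blast
    show "conjugate ?\<psi> W U ` reduced_problems W \<rho>' \<subseteq> reduced_problems U \<rho>"
      using conjugate_in_reduced_problems[OF repW \<psi>] by blast
  qed
  with \<phi> show ?thesis
    unfolding reduced_problems_equivalent_def by blast
qed


section \<open>Transfer between phase spaces\<close>

lemma monoid_representation_regular_action:
  "monoid_representation UNIV
    (regular_action :: 'm::{finite,monoid_mult} \<Rightarrow> ('v::euclidean_space, 'm) phase_space \<Rightarrow> _)"
  unfolding monoid_representation_def linear_between_def regular_action_def
  by (auto simp: vec_eq_iff mult.assoc)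

text \<open>The value in cell \<sigma> is the unit component after acting by \<sigma>, and
  equivariance moves this action inside \<open>L\<close>.\<close>

lemma network_field_equivariant:
  assumes "equivariant UNIV regular_action UNIV regular_action L"
  shows "network_field (\<lambda>(v, l). L v $ 1) v l = L v"
proof -
  have "L (\<chi> \<tau>. v $ (\<tau> * \<sigma>)) $ 1 = L v $ \<sigma>" for \<sigma>
    using equivariantD(3)[OF assms, of v \<sigma>] by (simp add: regular_action_def)
  then show ?thesis
    by (simp add: network_field_def vec_eq_iff)
qed

text \<open>Any indecomposable summand is the kernel of the projection to a complement, and by
  equivariance this projection is the network field of its component at the unit.\<close>

lemma ex_generic_bifurcation_of_projection:
  fixes P :: "('v::euclidean_space, 'm::{finite,monoid_mult}) phase_space \<Rightarrow> ('v, 'm) phase_space"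
  assumes "equivariant UNIV regular_action UNIV regular_action P" "\<And>x. P (P x) = P x"
    and "absolutely_indecomposable (range P) regular_action"
  shows "\<exists>g. generic_steady_state_bifurcation g \<and> generalized_kernel g = range P"
proof -
  let ?\<rho> = "regular_action :: 'm \<Rightarrow> ('v, 'm) phase_space \<Rightarrow> ('v, 'm) phase_space"
  note rep = monoid_representation_regular_action[where 'v = 'v and 'm = 'm]
  \<comment> \<open>\<open>L\<close> is the complementary projection: its kernel is
    \<open>range P\<close>, and being idempotent it has no further generalized kernel.\<close>
  define L where "L x = x - P x" for x
  define g where "g = (\<lambda>(v, l :: real). L v $ 1)"
  have linP: "linear P"
    using linear_betweenD(2,3)[OF equivariantD(1)[OF assms(1)]] by (auto intro: linearI)
  have eqL: "equivariant UNIV ?\<rho> UNIV ?\<rho> L"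
    using equivariant_add[OF rep equivariant_id equivariant_uminus[OF rep assms(1)]]
    by (simp add: L_def[abs_def])
  have linL: "linear L"
    using linear_betweenD(2,3)[OF equivariantD(1)[OF eqL]] by (auto intro: linearI)
  have field: "network_field g v l = L v" for v l
    unfolding g_def by (rule network_field_equivariant[OF eqL])
  have lz: "linearization g = L"
    unfolding linearization_def field
    by (intro frechet_derivative_at[symmetric] bounded_linear_imp_has_derivative
        linear_conv_bounded_linear[THEN iffD1] linL)
  have ker: "L x = 0 \<longleftrightarrow> x \<in> range P" for x
    using assms(2) by (auto simp: L_def)
  have LL: "L (L x) = L x" for x
    by (simp add: L_def linear_diff[OF linP] assms(2))
  have "(L ^^ Suc k) x = L x" for k x
    by (induction k) (simp_all add: LL)
  \<comment> \<open>Every positive power equals \<open>L\<close>; for \<open>k = 0\<close> the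
    condition says \<open>x = 0\<close>, whence \<open>L x = 0\<close>.\<close>
  then have "(\<exists>k. (L ^^ k) x = 0) \<longleftrightarrow> L x = 0" for x
    by (metis funpow_0 linear_0[OF linL] not0_implies_Suc)
  then have gk: "generalized_kernel g = range P"
    by (simp add: generalized_kernel_def lz ker)
  have ind: "indecomposable (range P) ?\<rho>"
    using assms(3) by (simp add: absolutely_indecomposable_def)
  obtain x where x: "x \<in> range P" "x \<noteq> 0"
    using ind monoid_representationD(1) subspace_0 unfolding indecomposable_def by blast
  have "linear g"
    unfolding g_def by (rule linearI) (auto simp: linear_add[OF linL] linear_scale[OF linL])
  then have "smooth_on UNIV g"
    by (rule smooth_on_linear)
  moreover have "has_eigenvalue UNIV (linearization g) 0"
    unfolding has_eigenvalue_def lz using x ker linear_0[OF linL] by (intro bexI[of _ x] bexI[of _ 0]) auto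
  ultimately have ssb: "steady_state_bifurcation g"
    by (simp add: steady_state_bifurcation_def field linear_0[OF linL])
  let ?K = "{x \<in> UNIV. P x = 0}"
  have "complementary (range P) ?K UNIV"
    unfolding complementary_def
  proof (intro conjI ballI)
    show "range P \<inter> ?K = {0}"
      using assms(2) linear_0[OF linP] by (auto simp: image_iff)
    show "\<exists>u\<in>range P. \<exists>w\<in>?K. x = u + w" for x
      by (intro bexI[of _ "P x"] bexI[of _ "x - P x"]) (auto simp: linear_diff[OF linP] assms(2))
  qed
  then have "indecomposable_component (range P) UNIV ?\<rho>"
    using equivariant_image_subrepresentation[OF rep rep assms(1)]
      equivariant_kernel_subrepresentation[OF rep rep assms(1)] ind
    by (intro indecomposable_componentI[OF rep])
  moreover have "rep_isomorphic (range P) ?\<rho> (range P) ?\<rho>"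
    unfolding rep_isomorphic_def rep_iso_def using equivariant_id by (metis bij_betw_id eq_id_iff)
  ultimately have "generic_steady_state_bifurcation g"
    unfolding generic_steady_state_bifurcation_def gk using ssb assms(3) by blast
  then show ?thesis
    using gk by blast
qed

text \<open>The relation \<open>ab\<close> between the two phase spaces is all that both directions
  share: \<iota> after \<pi> summed over all coordinates in one, \<pi> after \<iota> for a single
  coordinate in the other.\<close>

lemma generic_bifurcation_transfer:
  fixes f :: "('v::euclidean_space, 'm::{finite,monoid_mult}) phase_space \<times> real \<Rightarrow> 'v"
    and a :: "'j \<Rightarrow> ('w::euclidean_space, 'm) phase_space \<Rightarrow> ('v, 'm) phase_space"
  assumes "generic_steady_state_bifurcation f" "finite J"
    and a: "\<And>j. j \<in> J \<Longrightarrow> equivariant UNIV regular_action UNIV regular_action (a j)"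
    and b: "\<And>j. j \<in> J \<Longrightarrow> equivariant UNIV regular_action UNIV regular_action (b j)"
    and ab: "\<And>v. (\<Sum>j\<in>J. a j (b j v)) = v"
  obtains g :: "('w, 'm) phase_space \<times> real \<Rightarrow> 'w"
  where "generic_steady_state_bifurcation g"
    and "rep_isomorphic (generalized_kernel f) regular_action (generalized_kernel g) regular_action"
proof -
  let ?\<rho> = "regular_action :: 'm \<Rightarrow> ('v, 'm) phase_space \<Rightarrow> ('v, 'm) phase_space"
  let ?\<rho>' = "regular_action :: 'm \<Rightarrow> ('w, 'm) phase_space \<Rightarrow> ('w, 'm) phase_space"
  note rep = monoid_representation_regular_action[where 'v = 'v and 'm = 'm]
  note rep' = monoid_representation_regular_action[where 'v = 'w and 'm = 'm]
  obtain U where U: "indecomposable_component U UNIV ?\<rho>" "absolutely_indecomposable U ?\<rho>"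
      "rep_isomorphic (generalized_kernel f) ?\<rho> U ?\<rho>"
    using assms(1) unfolding generic_steady_state_bifurcation_def by blast
  have ind: "indecomposable U ?\<rho>"
    using U(2) by (simp add: absolutely_indecomposable_def)
  then have repU: "monoid_representation U ?\<rho>"
    by (simp add: indecomposable_def)
  obtain p where p: "equivariant UNIV ?\<rho> U ?\<rho> p" "\<And>u. u \<in> U \<Longrightarrow> p u = u"
    using indecomposable_component_projection[OF rep U(1)] by blast
  have bU: "equivariant U ?\<rho> UNIV ?\<rho>' (b j)" if "j \<in> J" for j
    by (rule equivariant_subset[OF b[OF that]]) auto
  \<comment> \<open>Since \<open>p\<close> fixes \<open>U\<close> and is additive, \<open>ab\<close>
    makes these endomorphisms of \<open>U\<close> sum to the identity.\<close>
  define h where "h j u = p (a j (b j u))" for j u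
  have h: "equivariant U ?\<rho> U ?\<rho> (h j)" if "j \<in> J" for j
    unfolding h_def
    by (rule equivariant_compose[OF equivariant_compose[OF bU[OF that] a[OF that]] p(1)])
  have "(\<Sum>j\<in>J. h j u) = u" if "u \<in> U" for u
    using linear_between_sum[OF equivariantD(1)[OF p(1)], of J "\<lambda>j. a j (b j u)"] p(2)[OF that] ab[of u]
    by (simp add: h_def)
  then have "inj_on (\<lambda>u. \<Sum>j\<in>J. h j u) U"
    by (intro inj_onI) simp
  from indecomposable_inj_summand[OF ind assms(2) h this]
  obtain j where j: "j \<in> J" "inj_on (h j) U" ..
  then have hiso: "rep_iso U ?\<rho> U ?\<rho> (h j)"
    using h[OF j(1)] linear_between_inj_on_iff_surj[OF equivariantD(1)[OF h[OF j(1)]] monoid_representationD(1)[OF repU]]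
    by (simp add: rep_iso_def bij_betw_def)
  let ?q = "inv_into U (h j)"
  note q = rep_isoD[OF rep_iso_inv_into[OF repU hiso]]
  have qh: "?q (h j u) = u" and hq: "h j (?q u) = u" if "u \<in> U" for u
    using bij_betw_inv_into_left[OF rep_isoD(2)[OF hiso] that]
      bij_betw_inv_into_right[OF rep_isoD(2)[OF hiso] that] by auto
  define P where "P x = b j (?q (p (a j x)))" for x
  have P: "equivariant UNIV ?\<rho>' UNIV ?\<rho>' P"
    unfolding P_def
    by (rule equivariant_compose[OF equivariant_compose[OF equivariant_compose[OF a[OF j(1)] p(1)] q(1)] bU[OF j(1)]])
  have Pb: "P (b j u) = b j u" if "u \<in> U" for u
    using qh[OF that] by (simp add: P_def h_def)
  have qU: "?q (p x) \<in> U" for x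
    using equivariantD(2)[OF q(1)] equivariantD(2)[OF p(1)] by blast
  have range: "range P = b j ` U"
  proof
    show "range P \<subseteq> b j ` U"
      using qU by (auto simp: P_def)
    show "b j ` U \<subseteq> range P"
      using Pb by (metis image_subsetI rangeI)
  qed
  have "P (P x) = P x" for x
    using Pb[OF qU] by (simp add: P_def)
  moreover have "inj_on (b j) U"
    using j(2) by (auto simp: inj_on_def h_def)
  then have biso: "rep_iso U ?\<rho> (range P) ?\<rho>' (b j)"
    unfolding rep_iso_def range using equivariant_subset[OF bU[OF j(1)] order_refl, of "b j ` U"]
    by (simp add: bij_betw_def)
  ultimately obtain g where "generic_steady_state_bifurcation g" "generalized_kernel g = range P"
    using ex_generic_bifurcation_of_projection[OF P] rep_iso_absolutely_indecomposable[OF U(2)] by blast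
  moreover have "rep_isomorphic (generalized_kernel f) ?\<rho> (range P) ?\<rho>'"
    using rep_isomorphic_trans[OF U(3)] biso unfolding rep_isomorphic_def by blast
  ultimately show thesis
    using that by metis
qed

text \<open>The regular action only reindexes cells, so it commutes with any map applied in every
  cell alike.\<close>

lemma equivariant_cellwise:
  assumes "linear c"
  shows "equivariant UNIV regular_action UNIV regular_action (\<lambda>v. \<chi> \<sigma>. c (v $ \<sigma>))"
  using assms unfolding equivariant_def linear_between_def regular_action_def
  by (auto simp: vec_eq_iff linear_add linear_scale)

theorem theorem3p1:
  fixes X :: "'x::real_vector set"
    and \<rho> :: "'m::{finite,monoid_mult} \<Rightarrow> 'x \<Rightarrow> 'x"
  assumes "monoid_representation X \<rho>"
  shows
    "((\<exists>f :: ((real ^ 'd, 'm) phase_space \<times> real \<Rightarrow> real ^ 'd).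
         generic_steady_state_bifurcation f \<and>
         rep_isomorphic X \<rho> (generalized_kernel f) regular_action)
      \<longleftrightarrow>
      (\<exists>g :: ((real, 'm) phase_space \<times> real \<Rightarrow> real).
         generic_steady_state_bifurcation g \<and>
         rep_isomorphic X \<rho> (generalized_kernel g) regular_action))
     \<and>
     (\<forall>(f :: ((real ^ 'd, 'm) phase_space \<times> real \<Rightarrow> real ^ 'd)) (g :: ((real, 'm) phase_space \<times> real \<Rightarrow> real)).
         generic_steady_state_bifurcation f \<and>
         rep_isomorphic X \<rho> (generalized_kernel f) regular_action \<and>
         generic_steady_state_bifurcation g \<and>
         rep_isomorphic X \<rho> (generalized_kernel g) regular_action
       \<longrightarrow> reduced_problems_equivalent (generalized_kernel f) regular_action
                                     (generalized_kernel g) regular_action)"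
proof (intro conjI iffI allI impI)
  define \<pi> :: "'d \<Rightarrow> (real ^ 'd, 'm) phase_space \<Rightarrow> (real, 'm) phase_space"
    where "\<pi> j v = (\<chi> \<sigma>. v $ \<sigma> $ j)" for j v
  define \<iota> :: "'d \<Rightarrow> (real, 'm) phase_space \<Rightarrow> (real ^ 'd, 'm) phase_space"
    where "\<iota> j v = (\<chi> \<sigma>. v $ \<sigma> *\<^sub>R axis j 1)" for j v
  have \<pi>: "equivariant UNIV regular_action UNIV regular_action (\<pi> j)" for j
    unfolding \<pi>_def by (rule equivariant_cellwise) (auto intro: linearI)
  have \<iota>: "equivariant UNIV regular_action UNIV regular_action (\<iota> j)" for j
    unfolding \<iota>_def by (rule equivariant_cellwise) (auto intro: linearI simp: scaleR_add_left)
  have \<iota>\<pi>: "(\<Sum>j\<in>UNIV. \<iota> j (\<pi> j v)) = v" for v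
    by (simp add: \<iota>_def \<pi>_def vec_eq_iff axis_def if_distrib[of "\<lambda>x. _ * x"] cong: if_cong)
  \<comment> \<open>One coordinate suffices in this direction. That some \<open>j0\<close> exists
    reflects \<open>d \<ge> 1\<close>, as types are nonempty.\<close>
  have \<pi>\<iota>: "(\<Sum>j\<in>{j0}. \<pi> j (\<iota> j v)) = v" for j0 v
    by (simp add: \<iota>_def \<pi>_def vec_eq_iff axis_def)
  {
    assume "\<exists>f :: ((real ^ 'd, 'm) phase_space \<times> real \<Rightarrow> real ^ 'd).
      generic_steady_state_bifurcation f \<and> rep_isomorphic X \<rho> (generalized_kernel f) regular_action"
    then obtain f :: "(real ^ 'd, 'm) phase_space \<times> real \<Rightarrow> real ^ 'd"
      where f: "generic_steady_state_bifurcation f"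
        "rep_isomorphic X \<rho> (generalized_kernel f) regular_action"
      by blast
    show "\<exists>g :: ((real, 'm) phase_space \<times> real \<Rightarrow> real).
      generic_steady_state_bifurcation g \<and> rep_isomorphic X \<rho> (generalized_kernel g) regular_action"
      by (rule generic_bifurcation_transfer[OF f(1) finite \<iota> \<pi> \<iota>\<pi>])
        (use rep_isomorphic_trans[OF f(2)] in blast)
  next
    assume "\<exists>g :: ((real, 'm) phase_space \<times> real \<Rightarrow> real).
      generic_steady_state_bifurcation g \<and> rep_isomorphic X \<rho> (generalized_kernel g) regular_action"
    then obtain g :: "(real, 'm) phase_space \<times> real \<Rightarrow> real"
      where g: "generic_steady_state_bifurcation g"
        "rep_isomorphic X \<rho> (generalized_kernel g) regular_action"
      by blast
    show "\<exists>f :: ((real ^ 'd, 'm) phase_space \<times> real \<Rightarrow> real ^ 'd).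
      generic_steady_state_bifurcation f \<and> rep_isomorphic X \<rho> (generalized_kernel f) regular_action"
      by (rule generic_bifurcation_transfer[OF g(1) _ \<pi> \<iota> \<pi>\<iota>])
        (use rep_isomorphic_trans[OF g(2)] in \<open>simp, blast\<close>)
  }
next
  fix f :: "(real ^ 'd, 'm) phase_space \<times> real \<Rightarrow> real ^ 'd"
    and g :: "(real, 'm) phase_space \<times> real \<Rightarrow> real"
  assume *: "generic_steady_state_bifurcation f \<and>
         rep_isomorphic X \<rho> (generalized_kernel f) regular_action \<and>
         generic_steady_state_bifurcation g \<and>
         rep_isomorphic X \<rho> (generalized_kernel g) regular_action"
  then have "rep_isomorphic (generalized_kernel f) regular_action (generalized_kernel g) regular_action"
    using rep_isomorphic_sym[OF assms] rep_isomorphic_trans by blast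
  \<comment> \<open>The structure is inherited from \<open>X\<close> through the assumed
    isomorphism, with no appeal to the linearization.\<close>
  moreover have "monoid_representation (generalized_kernel f) regular_action"
    using * rep_iso_monoid_representation[OF assms] unfolding rep_isomorphic_def by blast
  ultimately show "reduced_problems_equivalent (generalized_kernel f) regular_action
      (generalized_kernel g) regular_action"
    by (intro reduced_problems_equivalentI)
qed

end
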